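(* Let $M$ be a compact $3$-cosymplectic manifold of dimension $4n+3$, and let $b_k^h=\dim\Omega^k_{H,000}(M)$. Then for $0\le k\le n$ $$b_{2k}^h\ge\binom{k+2}{2}.$$
   Context: An almost contact metric structure $(\phi,\xi,\eta,g)$ on an odd-dimensional smooth manifold $M$ consists of a $(1,1)$-tensor field $\phi$, a vector field $\xi$, a $1$-form $\eta$ and a Riemannian metric $g$ with $\phi^2=-I+\eta\otimes\xi$, $\eta(\xi)=1$ and $g(\phi E,\phi F)=g(E,F)-\eta(E)\eta(F)$. Its fundamental $2$-form is $\Phi(E,F)=g(E,\phi F)$. It is cosymplectic if $d\eta=0$, $d\Phi=0$ and $[\phi,\phi]+2d\eta\otimes\xi=0$, where $[\phi,\phi]$ is the Nijenhuis torsion (equivalently, $\nabla\phi=0$). A $3$-cosymplectic manifold is a smooth manifold $M$ of dimension $4n+3$ with three cosymplectic structures $(\phi_\alpha,\xi_\alpha,\eta_\alpha,g)$, $\alpha=1,2,3$, with the same metric $g$, such that for all $\alpha,\beta$ $$\phi_\alpha\phi_\beta-\eta_\beta\otimes\xi_\alpha=\sum_{\gamma}\epsilon_{\alpha\beta\gamma}\phi_\gamma-\delta_{\alpha\beta}I,\quad \phi_\alpha\xi_\beta=\sum_\gamma\epsilon_{\alpha\beta\gamma}\xi_\gamma,\quad \eta_\alpha\circ\phi_\beta=\sum_\gamma\epsilon_{\alpha\beta\gamma}\eta_\gamma,$$ with $\epsilon_{\alpha\beta\gamma}$ the totally antisymmetric symbol. $\Omega^k_{H,000}(M)$ is the space of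 harmonic $k$-forms $\omega$ on $M$ with $e_\alpha\omega=0$ for $\alpha=1,2,3$, where $e_\alpha\omega=\eta_\alpha\wedge i_{\xi_\alpha}\omega$. The numbers $b_k^h$ are the basic Betti numbers of the foliation spanned by $\xi_1,\xi_2,\xi_3$. *)

theory Defs
  imports "HOL-Analysis.Analysis" "HOL-Library.Function_Algebras" "HOL-Library.Extended_Nat"
begin

section \<open>Smooth maps between open sets of Euclidean spaces\<close>

primrec Ck_on :: "nat \<Rightarrow> ('e::euclidean_space \<Rightarrow> 'f::real_normed_vector) \<Rightarrow> 'e set \<Rightarrow> bool" where
  "Ck_on 0 f S \<longleftrightarrow> continuous_on S f"
| "Ck_on (Suc k) f S \<longleftrightarrow>
     (\<forall>x\<in>S. f differentiable (at x)) \<and> (\<forall>v. Ck_on k (\<lambda>x. frechet_derivative f (at x) v) S)"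

text \<open>Intended for open \<open>S\<close> only.\<close>

definition smooth_on :: "('e::euclidean_space \<Rightarrow> 'f::real_normed_vector) \<Rightarrow> 'e set \<Rightarrow> bool" where
  "smooth_on f S \<longleftrightarrow> (\<forall>k. Ck_on k f S)"


section \<open>Smooth manifolds\<close>

text \<open>The manifold is the whole type \<open>'a\<close>. A chart is a domain together with a coordinate map;
  the coordinate map is irrelevant outside the domain.\<close>

type_synonym ('a, 'e) chart = "'a set \<times> ('a \<Rightarrow> 'e)"

definition chart_inv :: "('a, 'e) chart \<Rightarrow> 'e \<Rightarrow> 'a" where
  "chart_inv c = inv_into (fst c) (snd c)"

definition chart_image :: "('a, 'e) chart \<Rightarrow> 'e set" where
  "chart_image c = snd c ` fst c"

definition is_chart :: "('a::topological_space, 'e::euclidean_space) chart \<Rightarrow> bool" where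
  "is_chart c \<longleftrightarrow> open (fst c) \<and> open (chart_image c) \<and>
     homeomorphism (fst c) (chart_image c) (snd c) (chart_inv c)"

definition smooth_atlas :: "('a::topological_space, 'e::euclidean_space) chart set \<Rightarrow> bool" where
  "smooth_atlas A \<longleftrightarrow>
     (\<forall>c\<in>A. is_chart c) \<and> (\<Union>c\<in>A. fst c) = UNIV \<and>
     (\<forall>c\<in>A. \<forall>d\<in>A. smooth_on (snd d \<circ> chart_inv c) (snd c ` (fst c \<inter> fst d)))"

text \<open>The tangent space at \<open>p\<close> is represented by the model space \<open>'e\<close>, through one chart
  around \<open>p\<close> that is selected once and for all. Hence a tensor field assigns to each point a
  tensor on \<open>'e\<close>. As the selected chart may jump from point to point, smoothness and
  derivatives of tensor fields only make sense after passing to the components with respect to a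
  fixed chart; this is what \<open>to_tangent\<close> and \<open>of_tangent\<close> do.\<close>

definition chart_at :: "('a, 'e) chart set \<Rightarrow> 'a \<Rightarrow> ('a, 'e) chart" where
  "chart_at A p = (SOME c. c \<in> A \<and> p \<in> fst c)"

definition coord_at :: "('a, 'e) chart set \<Rightarrow> 'a \<Rightarrow> 'e" where
  "coord_at A p = snd (chart_at A p) p"

text \<open>The tangent vector at \<open>q\<close> with component vector \<open>v\<close> in the chart \<open>c\<close>, and conversely the
  component vector in \<open>c\<close> of a tangent vector at \<open>q\<close>.\<close>

definition to_tangent ::
  "('a, 'e::euclidean_space) chart set \<Rightarrow> ('a, 'e) chart \<Rightarrow> 'a \<Rightarrow> 'e \<Rightarrow> 'e" where
  "to_tangent A c q = frechet_derivative (snd (chart_at A q) \<circ> chart_inv c) (at (snd c q))"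

definition of_tangent ::
  "('a, 'e::euclidean_space) chart set \<Rightarrow> ('a, 'e) chart \<Rightarrow> 'a \<Rightarrow> 'e \<Rightarrow> 'e" where
  "of_tangent A c q = frechet_derivative (snd c \<circ> chart_inv (chart_at A q)) (at (coord_at A q))"


section \<open>Tensor fields\<close>

text \<open>A \<open>k\<close>-form takes the list of its \<open>k\<close> arguments; it is set to \<open>0\<close> on lists of other lengths.\<close>

type_synonym 'e covector = "'e list \<Rightarrow> real"
type_synonym ('a, 'e) vfield = "'a \<Rightarrow> 'e"
type_synonym ('a, 'e) form = "'a \<Rightarrow> 'e covector"
type_synonym ('a, 'e) endo = "'a \<Rightarrow> 'e \<Rightarrow> 'e"
type_synonym ('a, 'e) bilin = "'a \<Rightarrow> 'e \<Rightarrow> 'e \<Rightarrow> real"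

definition vfield_rep ::
  "('a, 'e::euclidean_space) chart set \<Rightarrow> ('a, 'e) chart \<Rightarrow> ('a, 'e) vfield \<Rightarrow> 'e \<Rightarrow> 'e" where
  "vfield_rep A c X x = (let q = chart_inv c x in of_tangent A c q (X q))"

definition form_rep ::
  "('a, 'e::euclidean_space) chart set \<Rightarrow> ('a, 'e) chart \<Rightarrow> ('a, 'e) form \<Rightarrow> 'e \<Rightarrow> 'e covector" where
  "form_rep A c \<omega> x vs = (let q = chart_inv c x in \<omega> q (map (to_tangent A c q) vs))"

definition endo_rep ::
  "('a, 'e::euclidean_space) chart set \<Rightarrow> ('a, 'e) chart \<Rightarrow> ('a, 'e) endo \<Rightarrow> 'e \<Rightarrow> 'e \<Rightarrow> 'e" where
  "endo_rep A c \<phi> x v = (let q = chart_inv c x in of_tangent A c q (\<phi> q (to_tangent A c q v)))"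

definition bilin_rep ::
  "('a, 'e::euclidean_space) chart set \<Rightarrow> ('a, 'e) chart \<Rightarrow> ('a, 'e) bilin \<Rightarrow> 'e \<Rightarrow> 'e \<Rightarrow> 'e \<Rightarrow> real" where
  "bilin_rep A c g x u v =
     (let q = chart_inv c x in g q (to_tangent A c q u) (to_tangent A c q v))"

definition smooth_vfield :: "('a, 'e::euclidean_space) chart set \<Rightarrow> ('a, 'e) vfield \<Rightarrow> bool" where
  "smooth_vfield A X \<longleftrightarrow> (\<forall>c\<in>A. smooth_on (vfield_rep A c X) (chart_image c))"

definition smooth_endo :: "('a, 'e::euclidean_space) chart set \<Rightarrow> ('a, 'e) endo \<Rightarrow> bool" where
  "smooth_endo A \<phi> \<longleftrightarrow> (\<forall>p. linear (\<phi> p)) \<and>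
     (\<forall>c\<in>A. \<forall>v. smooth_on (\<lambda>x. endo_rep A c \<phi> x v) (chart_image c))"

definition riemannian_metric :: "('a, 'e::euclidean_space) chart set \<Rightarrow> ('a, 'e) bilin \<Rightarrow> bool" where
  "riemannian_metric A g \<longleftrightarrow>
     (\<forall>p. bilinear (g p) \<and> (\<forall>u v. g p u v = g p v u) \<and> (\<forall>u. u \<noteq> 0 \<longrightarrow> g p u u > 0)) \<and>
     (\<forall>c\<in>A. \<forall>u v. smooth_on (\<lambda>x. bilin_rep A c g x u v) (chart_image c))"

definition alternating :: "nat \<Rightarrow> 'e::real_vector covector \<Rightarrow> bool" where
  "alternating k \<alpha> \<longleftrightarrow>
     (\<forall>vs. length vs \<noteq> k \<longrightarrow> \<alpha> vs = 0) \<and>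
     (\<forall>vs i. length vs = k \<and> i < k \<longrightarrow> linear (\<lambda>v. \<alpha> (vs[i := v]))) \<and>
     (\<forall>vs i j. length vs = k \<and> i < j \<and> j < k \<and> vs ! i = vs ! j \<longrightarrow> \<alpha> vs = 0)"

definition forms :: "('a, 'e::euclidean_space) chart set \<Rightarrow> nat \<Rightarrow> ('a, 'e) form set" where
  "forms A k = {\<omega>. (\<forall>p. alternating k (\<omega> p)) \<and>
     (\<forall>c\<in>A. \<forall>vs. smooth_on (\<lambda>x. form_rep A c \<omega> x vs) (chart_image c))}"


section \<open>Operations on forms and vector fields\<close>

text \<open>The wedge product of a \<open>k\<close>-form with an \<open>l\<close>-form, normalised so that
  \<open>(\<alpha> \<and> \<beta>) [u, v] = \<alpha> [u] * \<beta> [v] - \<alpha> [v] * \<beta> [u]\<close> for 1-forms.\<close>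

definition wedge :: "nat \<Rightarrow> nat \<Rightarrow> ('a, 'e) form \<Rightarrow> ('a, 'e) form \<Rightarrow> ('a, 'e) form" where
  "wedge k l \<alpha> \<beta> p vs =
     (if length vs = k + l
      then (\<Sum>\<sigma> | \<sigma> permutes {..<k + l}. of_int (sign \<sigma>) *
              \<alpha> p (map (\<lambda>i. vs ! \<sigma> i) [0..<k]) * \<beta> p (map (\<lambda>i. vs ! \<sigma> i) [k..<k + l]))
           / (fact k * fact l)
      else 0)"

definition contract :: "('a, 'e) vfield \<Rightarrow> ('a, 'e) form \<Rightarrow> ('a, 'e) form" where
  "contract X \<omega> p vs = \<omega> p (X p # vs)"

text \<open>The derivatives below are evaluated at \<open>p\<close> in the chart selected at \<open>p\<close>, whose
  identification of the tangent space at \<open>p\<close> with \<open>'e\<close> is the identity.\<close>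

definition ext_deriv :: "('a, 'e::euclidean_space) chart set \<Rightarrow> ('a, 'e) form \<Rightarrow> ('a, 'e) form" where
  "ext_deriv A \<omega> p vs =
     (\<Sum>i<length vs. (-1) ^ i *
        frechet_derivative
          (\<lambda>x. form_rep A (chart_at A p) \<omega> x (take i vs @ drop (Suc i) vs))
          (at (coord_at A p)) (vs ! i))"

definition lie_bracket ::
  "('a, 'e::euclidean_space) chart set \<Rightarrow> ('a, 'e) vfield \<Rightarrow> ('a, 'e) vfield \<Rightarrow> ('a, 'e) vfield" where
  "lie_bracket A X Y p =
     frechet_derivative (vfield_rep A (chart_at A p) Y) (at (coord_at A p)) (X p)
     - frechet_derivative (vfield_rep A (chart_at A p) X) (at (coord_at A p)) (Y p)"

text \<open>The Nijenhuis torsion is a tensor, so its value on two tangent vectors at \<open>p\<close> can be computed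
  with any vector fields near \<open>p\<close> extending them; we use those with constant components in the
  chart selected at \<open>p\<close>.\<close>

definition nijenhuis :: "('a, 'e::euclidean_space) chart set \<Rightarrow> ('a, 'e) endo \<Rightarrow> 'a \<Rightarrow> 'e \<Rightarrow> 'e \<Rightarrow> 'e" where
  "nijenhuis A \<phi> p u v =
     (let X = (\<lambda>q. to_tangent A (chart_at A p) q u);
          Y = (\<lambda>q. to_tangent A (chart_at A p) q v);
          \<phi>X = (\<lambda>q. \<phi> q (X q));
          \<phi>Y = (\<lambda>q. \<phi> q (Y q))
      in \<phi> p (\<phi> p (lie_bracket A X Y p)) + lie_bracket A \<phi>X \<phi>Y p
         - \<phi> p (lie_bracket A \<phi>X Y p) - \<phi> p (lie_bracket A X \<phi>Y p))"


section \<open>Levi-Civita connection, codifferential and Laplacian\<close>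

text \<open>\<open>christoffel A g p u v\<close> is the covariant derivative at \<open>p\<close>, in the direction \<open>u\<close>, of the field
  with constant components \<open>v\<close> in the chart selected at \<open>p\<close>; it is given by the Koszul formula,
  in which all Lie brackets of such fields vanish.\<close>

definition christoffel ::
  "('a, 'e::euclidean_space) chart set \<Rightarrow> ('a, 'e) bilin \<Rightarrow> 'a \<Rightarrow> 'e \<Rightarrow> 'e \<Rightarrow> 'e" where
  "christoffel A g p u v =
     (let D = (\<lambda>w a b. frechet_derivative (\<lambda>x. bilin_rep A (chart_at A p) g x a b)
                         (at (coord_at A p)) w)
      in THE z. \<forall>w. 2 * g p z w = D u v w + D v u w - D w u v)"

definition nabla ::
  "('a, 'e::euclidean_space) chart set \<Rightarrow> ('a, 'e) bilin \<Rightarrow> 'a \<Rightarrow> 'e \<Rightarrow> ('a, 'e) form \<Rightarrow> 'e covector" where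
  "nabla A g p u \<omega> vs =
     frechet_derivative (\<lambda>x. form_rep A (chart_at A p) \<omega> x vs) (at (coord_at A p)) u
     - (\<Sum>i<length vs. \<omega> p (vs[i := christoffel A g p u (vs ! i)]))"

definition orthonormal_frame :: "('a, 'e::euclidean_space) bilin \<Rightarrow> 'a \<Rightarrow> 'e set" where
  "orthonormal_frame g p =
     (SOME E. finite E \<and> card E = DIM('e) \<and> (\<forall>u\<in>E. \<forall>v\<in>E. g p u v = (if u = v then 1 else 0)))"

text \<open>The codifferential is minus the metric trace of the covariant derivative, which agrees with
  the definition through the Hodge star but needs no orientation.\<close>

definition codiff ::
  "('a, 'e::euclidean_space) chart set \<Rightarrow> ('a, 'e) bilin \<Rightarrow> ('a, 'e) form \<Rightarrow> ('a, 'e) form" where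
  "codiff A g \<omega> p vs = - (\<Sum>u\<in>orthonormal_frame g p. nabla A g p u \<omega> (u # vs))"

definition laplacian ::
  "('a, 'e::euclidean_space) chart set \<Rightarrow> ('a, 'e) bilin \<Rightarrow> ('a, 'e) form \<Rightarrow> ('a, 'e) form" where
  "laplacian A g \<omega> p vs = ext_deriv A (codiff A g \<omega>) p vs + codiff A g (ext_deriv A \<omega>) p vs"

definition harmonic_forms ::
  "('a, 'e::euclidean_space) chart set \<Rightarrow> ('a, 'e) bilin \<Rightarrow> nat \<Rightarrow> ('a, 'e) form set" where
  "harmonic_forms A g k = {\<omega> \<in> forms A k. \<forall>p vs. laplacian A g \<omega> p vs = 0}"


section \<open>Cosymplectic and 3-cosymplectic structures\<close>

definition almost_contact_metric ::
  "('a, 'e::euclidean_space) chart set \<Rightarrow> ('a, 'e) endo \<Rightarrow> ('a, 'e) vfield \<Rightarrow> ('a, 'e) form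
    \<Rightarrow> ('a, 'e) bilin \<Rightarrow> bool" where
  "almost_contact_metric A \<phi> \<xi> \<eta> g \<longleftrightarrow>
     odd DIM('e) \<and> smooth_endo A \<phi> \<and> smooth_vfield A \<xi> \<and> \<eta> \<in> forms A 1 \<and> riemannian_metric A g \<and>
     (\<forall>p u. \<phi> p (\<phi> p u) = - u + \<eta> p [u] *\<^sub>R \<xi> p) \<and>
     (\<forall>p. \<eta> p [\<xi> p] = 1) \<and>
     (\<forall>p u v. g p (\<phi> p u) (\<phi> p v) = g p u v - \<eta> p [u] * \<eta> p [v])"

definition fundamental_form :: "('a, 'e) endo \<Rightarrow> ('a, 'e) bilin \<Rightarrow> ('a, 'e) form" where
  "fundamental_form \<phi> g p vs = (if length vs = 2 then g p (vs ! 0) (\<phi> p (vs ! 1)) else 0)"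

definition cosymplectic ::
  "('a, 'e::euclidean_space) chart set \<Rightarrow> ('a, 'e) endo \<Rightarrow> ('a, 'e) vfield \<Rightarrow> ('a, 'e) form
    \<Rightarrow> ('a, 'e) bilin \<Rightarrow> bool" where
  "cosymplectic A \<phi> \<xi> \<eta> g \<longleftrightarrow>
     almost_contact_metric A \<phi> \<xi> \<eta> g \<and>
     (\<forall>p vs. ext_deriv A \<eta> p vs = 0) \<and>
     (\<forall>p vs. ext_deriv A (fundamental_form \<phi> g) p vs = 0) \<and>
     (\<forall>p u v. nijenhuis A \<phi> p u v + (2 * ext_deriv A \<eta> p [u, v]) *\<^sub>R \<xi> p = 0)"

definition levi_civita :: "nat \<Rightarrow> nat \<Rightarrow> nat \<Rightarrow> real" where
  "levi_civita a b c =
     (if (a, b, c) \<in> {(1, 2, 3), (2, 3, 1), (3, 1, 2)} then 1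
      else if (a, b, c) \<in> {(1, 3, 2), (3, 2, 1), (2, 1, 3)} then -1
      else 0)"

definition three_cosymplectic ::
  "('a, 'e::euclidean_space) chart set \<Rightarrow> nat \<Rightarrow> (nat \<Rightarrow> ('a, 'e) endo) \<Rightarrow> (nat \<Rightarrow> ('a, 'e) vfield)
    \<Rightarrow> (nat \<Rightarrow> ('a, 'e) form) \<Rightarrow> ('a, 'e) bilin \<Rightarrow> bool" where
  "three_cosymplectic A n \<phi> \<xi> \<eta> g \<longleftrightarrow>
     DIM('e) = 4 * n + 3 \<and>
     (\<forall>a\<in>{1..3}. cosymplectic A (\<phi> a) (\<xi> a) (\<eta> a) g) \<and>
     (\<forall>a\<in>{1..3}. \<forall>b\<in>{1..3}. \<forall>p.
        (\<forall>u. \<phi> a p (\<phi> b p u) - \<eta> b p [u] *\<^sub>R \<xi> a p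
             = (\<Sum>c\<in>{1..3}. levi_civita a b c *\<^sub>R \<phi> c p u) - (if a = b then u else 0)) \<and>
        \<phi> a p (\<xi> b p) = (\<Sum>c\<in>{1..3}. levi_civita a b c *\<^sub>R \<xi> c p) \<and>
        (\<forall>u. \<eta> a p [\<phi> b p u] = (\<Sum>c\<in>{1..3}. levi_civita a b c * \<eta> c p [u])))"


section \<open>Dimension of spaces of forms\<close>

interpretation form_space: vector_space "\<lambda>r (\<omega>::('a, 'e) form) p vs. r * \<omega> p vs"
  by unfold_locales (auto simp: fun_eq_iff algebra_simps)

text \<open>The library dimension of an infinite-dimensional subspace is \<open>0\<close>, here it is \<open>\<infinity>\<close>.\<close>

definition form_dim :: "('a, 'e) form set \<Rightarrow> enat" where
  "form_dim V =
     (if \<exists>B. finite B \<and> V \<subseteq> module.span (\<lambda>r \<omega> p vs. r * \<omega> p vs) B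
      then enat (vector_space.dim (\<lambda>r \<omega> p vs. r * \<omega> p vs) V)
      else \<infinity>)"

text \<open>The operator \<open>\<omega> \<mapsto> \<eta> \<and> i\<^sub>\<xi> \<omega>\<close> on \<open>k\<close>-forms; it is \<open>0\<close> on functions, where the contraction vanishes.\<close>

definition e_op :: "nat \<Rightarrow> ('a, 'e) vfield \<Rightarrow> ('a, 'e) form \<Rightarrow> ('a, 'e) form \<Rightarrow> ('a, 'e) form" where
  "e_op k \<xi> \<eta> \<omega> = wedge 1 (k - 1) \<eta> (contract \<xi> \<omega>)"

definition harmonic_forms_000 ::
  "('a, 'e::euclidean_space) chart set \<Rightarrow> (nat \<Rightarrow> ('a, 'e) vfield) \<Rightarrow> (nat \<Rightarrow> ('a, 'e) form)
    \<Rightarrow> ('a, 'e) bilin \<Rightarrow> nat \<Rightarrow> ('a, 'e) form set" where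
  "harmonic_forms_000 A \<xi> \<eta> g k =
     {\<omega> \<in> harmonic_forms A g k. \<forall>a\<in>{1..3}. \<forall>p vs. e_op k (\<xi> a) (\<eta> a) \<omega> p vs = 0}"

definition basic_betti ::
  "('a, 'e::euclidean_space) chart set \<Rightarrow> (nat \<Rightarrow> ('a, 'e) vfield) \<Rightarrow> (nat \<Rightarrow> ('a, 'e) form)
    \<Rightarrow> ('a, 'e) bilin \<Rightarrow> nat \<Rightarrow> enat" where
  "basic_betti A \<xi> \<eta> g k = form_dim (harmonic_forms_000 A \<xi> \<eta> g k)"

end

theory Submission
  imports Defs
begin

text \<open>The horizontal parts of the three fundamental 2-forms,
  \<open>\<Xi>\<^sub>a = \<Phi>\<^sub>a + \<Sum>b c. \<epsilon>\<^sub>a\<^sub>b\<^sub>c \<eta>\<^sub>b \<otimes> \<eta>\<^sub>c\<close>, are parallel, because the cosymplectic conditions force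
  \<open>\<nabla>\<phi> = 0\<close> and \<open>\<nabla>\<eta> = 0\<close>; they are annihilated by the Reeb fields. Hence the products of \<open>i\<close>
  copies of \<open>\<Xi>\<^sub>1\<close>, \<open>j\<close> of \<open>\<Xi>\<^sub>2\<close> and \<open>k - i - j\<close> of \<open>\<Xi>\<^sub>3\<close> are parallel and so harmonic.
  For \<open>k \<le> n\<close> a tangent space contains horizontal vectors
  \<open>e\<^sub>0, \<dots>, e\<^sub>k\<^sub>-\<^sub>1\<close> spanning orthogonal quaternionic lines. On the arguments
  \<open>\<phi>\<^sub>b\<^sub>(\<^sub>0\<^sub>) e\<^sub>0, e\<^sub>0, \<phi>\<^sub>b\<^sub>(\<^sub>1\<^sub>) e\<^sub>1, e\<^sub>1, \<dots>\<close> only the product with the same multiset of indices as \<open>b\<close> is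
  nonzero, so the \<open>(k + 2) choose 2\<close> products are linearly independent.\<close>

section \<open>Calculus of smooth functions\<close>

text \<open>The chart that identifies a tangent space with the model space may jump between points,
  so parallelism is handled as a condition on first derivatives at each \<open>p\<close>, read in
  the chart selected at \<open>p\<close>: the derivative of B(u, v) in direction w, for constant u
  and v, is B(\<Gamma> w u, v) + B(u, \<Gamma> w v). By the Leibniz rule this condition passes to
  sums and products, so it has to be established only for each fundamental form and each contact
  form. The obstacle there is that closedness and integrability control only alternating
  combinations of the covariant derivative of \<Phi>. Compatibility with the metric supplies further
  symmetries, and together they force the tensor to equal its own negative. Harmonicity is then
  pointwise, since the exterior derivative and the codifferential are the alternation and the trace
  of a covariant derivative that is zero. The binomial coefficient counts exponent pairs (i, j) with
  i + j \<le> k, and k \<le> n reflects that the horizontal space has dimension 4n.\<close>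

lemma Ck_on_cong:
  assumes "open S" "\<And>x. x \<in> S \<Longrightarrow> f x = g x" "Ck_on k f S"
  shows "Ck_on k g S"
  using assms(2,3)
proof (induction k arbitrary: f g)
  case 0
  then show ?case by (metis Ck_on.simps(1) continuous_on_cong)
next
  case (Suc k)
  have der: "(g has_derivative frechet_derivative f (at x)) (at x)" if "x \<in> S" for x
    using has_derivative_transform_within_open[OF _ assms(1) that] Suc.prems that
    by (meson Ck_on.simps(2) frechet_derivative_works)
  have eq: "frechet_derivative f (at x) = frechet_derivative g (at x)" if "x \<in> S" for x
    using der[OF that] frechet_derivative_at by blast
  have "Ck_on k (\<lambda>x. frechet_derivative g (at x) v) S" for v
    by (rule Suc.IH[where f = "\<lambda>x. frechet_derivative f (at x) v"]) (use Suc.prems eq in auto)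
  then show ?case using der by (auto simp: differentiable_def)
qed

text \<open>Allows the derivative to be given by any formula, so that the sum and product rules can
  be fed directly into inductions on the order.\<close>

lemma Ck_on_SucI:
  assumes "open S" "\<And>x. x \<in> S \<Longrightarrow> (f has_derivative f' x) (at x)" "\<And>v. Ck_on k (\<lambda>x. f' x v) S"
  shows "Ck_on (Suc k) f S"
proof -
  have "Ck_on k (\<lambda>x. frechet_derivative f (at x) v) S" for v
    by (rule Ck_on_cong[OF assms(1) _ assms(3)[of v]]) (metis assms(2) frechet_derivative_at)
  then show ?thesis using assms(2) by (auto simp: differentiable_def)
qed

lemma Ck_on_has_derivative:
  "Ck_on (Suc k) f S \<Longrightarrow> x \<in> S \<Longrightarrow> (f has_derivative frechet_derivative f (at x)) (at x)"
  using frechet_derivative_works by auto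

lemma Ck_on_Suc_imp: "Ck_on (Suc k) f S \<Longrightarrow> Ck_on k f S"
proof (induction k arbitrary: f)
  case 0
  then show ?case
    by (auto intro!: continuous_at_imp_continuous_on differentiable_imp_continuous_within)
qed simp

lemma Ck_on_const: "Ck_on k (\<lambda>x. c) S"
  by (induction k arbitrary: c) (auto simp: frechet_derivative_const)

lemma Ck_on_add:
  assumes "open S"
  shows "Ck_on k f S \<Longrightarrow> Ck_on k g S \<Longrightarrow> Ck_on k (\<lambda>x. f x + g x) S"
proof (induction k arbitrary: f g)
  case (Suc k)
  show ?case
    by (rule Ck_on_SucI[OF assms has_derivative_add[OF Ck_on_has_derivative[OF Suc.prems(1)]
          Ck_on_has_derivative[OF Suc.prems(2)]]]) (use Suc in auto)
qed (auto intro: continuous_intros)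

lemma Ck_on_mult:
  fixes f g :: "'e::euclidean_space \<Rightarrow> real"
  assumes "open S"
  shows "Ck_on k f S \<Longrightarrow> Ck_on k g S \<Longrightarrow> Ck_on k (\<lambda>x. f x * g x) S"
proof (induction k arbitrary: f g)
  case (Suc k)
  show ?case
  proof (rule Ck_on_SucI[OF assms has_derivative_mult[OF Ck_on_has_derivative[OF Suc.prems(1)]
          Ck_on_has_derivative[OF Suc.prems(2)]]])
    fix v
    show "Ck_on k (\<lambda>x. f x * frechet_derivative g (at x) v + frechet_derivative f (at x) v * g x) S"
      using Suc Ck_on_Suc_imp[OF Suc.prems(1)] Ck_on_Suc_imp[OF Suc.prems(2)]
      by (auto intro!: Ck_on_add[OF assms])
  qed
qed (auto intro: continuous_intros)

lemma Ck_on_inner_left: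
  fixes f :: "'e::euclidean_space \<Rightarrow> 'f::euclidean_space"
  assumes "open S"
  shows "Ck_on k f S \<Longrightarrow> Ck_on k (\<lambda>x. f x \<bullet> b) S"
proof (induction k arbitrary: f)
  case (Suc k)
  show ?case
    by (rule Ck_on_SucI[OF assms has_derivative_inner_left[OF Ck_on_has_derivative[OF Suc.prems]]])
      (use Suc in auto)
qed (auto intro: continuous_intros)

lemma smooth_on_cong:
  assumes "open S" "smooth_on f S" "\<And>x. x \<in> S \<Longrightarrow> f x = g x"
  shows "smooth_on g S"
  using Ck_on_cong[OF assms(1,3)] assms(2) by (auto simp: smooth_on_def)

lemma smooth_on_const: "smooth_on (\<lambda>x. c) S"
  by (simp add: smooth_on_def Ck_on_const)

lemma smooth_on_add:
  "open S \<Longrightarrow> smooth_on f S \<Longrightarrow> smooth_on g S \<Longrightarrow> smooth_on (\<lambda>x. f x + g x) S"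
  by (simp add: smooth_on_def Ck_on_add)

lemma smooth_on_mult:
  fixes f g :: "'e::euclidean_space \<Rightarrow> real"
  shows "open S \<Longrightarrow> smooth_on f S \<Longrightarrow> smooth_on g S \<Longrightarrow> smooth_on (\<lambda>x. f x * g x) S"
  by (simp add: smooth_on_def Ck_on_mult)

lemma smooth_on_inner_left:
  fixes f :: "'e::euclidean_space \<Rightarrow> 'f::euclidean_space"
  shows "open S \<Longrightarrow> smooth_on f S \<Longrightarrow> smooth_on (\<lambda>x. f x \<bullet> b) S"
  by (simp add: smooth_on_def Ck_on_inner_left)

lemma smooth_on_sum:
  "open S \<Longrightarrow> (\<And>i. i \<in> I \<Longrightarrow> smooth_on (f i) S) \<Longrightarrow> smooth_on (\<lambda>x. \<Sum>i\<in>I. f i x) S"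
  by (induction I rule: infinite_finite_induct) (simp_all add: smooth_on_const smooth_on_add)

lemma smooth_on_prod:
  fixes f :: "'i \<Rightarrow> 'e::euclidean_space \<Rightarrow> real"
  shows "open S \<Longrightarrow> (\<And>i. i \<in> I \<Longrightarrow> smooth_on (f i) S) \<Longrightarrow> smooth_on (\<lambda>x. \<Prod>i\<in>I. f i x) S"
  by (induction I rule: infinite_finite_induct) (simp_all add: smooth_on_const smooth_on_mult)

lemma smooth_on_has_derivative:
  "smooth_on f S \<Longrightarrow> x \<in> S \<Longrightarrow> (f has_derivative frechet_derivative f (at x)) (at x)"
  unfolding smooth_on_def using Ck_on_has_derivative by blast

section \<open>Charts and tangent spaces\<close>

context
  fixes A :: "('a::topological_space, 'e::euclidean_space) chart set"
  assumes atlas: "smooth_atlas A"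
begin

lemma chart_at_in_atlas: "chart_at A p \<in> A" and point_in_chart_at: "p \<in> fst (chart_at A p)"
proof -
  have "\<exists>c. c \<in> A \<and> p \<in> fst c"
    using atlas unfolding smooth_atlas_def by (metis UNIV_I UN_iff)
  from someI_ex[OF this] show "chart_at A p \<in> A" "p \<in> fst (chart_at A p)"
    by (auto simp: chart_at_def)
qed

lemma atlas_chart: "c \<in> A \<Longrightarrow> is_chart c"
  using atlas by (auto simp: smooth_atlas_def)

lemma open_chart_image: "c \<in> A \<Longrightarrow> open (chart_image c)"
  using atlas_chart by (auto simp: is_chart_def)

lemma chart_inv_chart: "c \<in> A \<Longrightarrow> q \<in> fst c \<Longrightarrow> chart_inv c (snd c q) = q"
  using atlas_chart by (auto simp: is_chart_def homeomorphism_def)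

lemma chart_chart_inv: "c \<in> A \<Longrightarrow> x \<in> chart_image c \<Longrightarrow> snd c (chart_inv c x) = x"
  using atlas_chart by (auto simp: is_chart_def homeomorphism_def)

lemma chart_inv_in: "c \<in> A \<Longrightarrow> x \<in> chart_image c \<Longrightarrow> chart_inv c x \<in> fst c"
  using atlas_chart unfolding is_chart_def homeomorphism_def by blast

lemma chart_image_mem: "q \<in> fst c \<Longrightarrow> snd c q \<in> chart_image c"
  by (auto simp: chart_image_def)

lemma open_overlap_image:
  assumes "c \<in> A" "d \<in> A" shows "open (snd c ` (fst c \<inter> fst d))"
proof -
  have "openin (top_of_set (chart_image c)) (snd c ` (fst c \<inter> fst d))"
    using atlas_chart[OF assms(1)] atlas_chart[OF assms(2)]
    by (intro homeomorphism_imp_open_map[of "fst c" _ _ "chart_inv c"])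
      (auto simp: is_chart_def openin_open_Int)
  then show ?thesis using open_chart_image[OF assms(1)] openin_open_trans by blast
qed

text \<open>The two transition maps compose to the identity near \<open>snd c q\<close>, and the
  chain rule carries this to their derivatives. Since \<open>chart_at A q\<close> is itself a chart
  of the atlas, both round trips between \<open>to_tangent\<close> and \<open>of_tangent\<close> are
  instances.\<close>

lemma transition_inverse:
  assumes "c \<in> A" "d \<in> A" "q \<in> fst c" "q \<in> fst d"
  shows "frechet_derivative (snd c \<circ> chart_inv d) (at (snd d q)) \<circ>
         frechet_derivative (snd d \<circ> chart_inv c) (at (snd c q)) = id"
proof -
  have 1: "((snd d \<circ> chart_inv c) has_derivative frechet_derivative (snd d \<circ> chart_inv c) (at (snd c q)))
      (at (snd c q))"
    by (rule smooth_on_has_derivative[of _ "snd c ` (fst c \<inter> fst d)"])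
      (use atlas assms in \<open>auto simp: smooth_atlas_def\<close>)
  have 2: "((snd c \<circ> chart_inv d) has_derivative frechet_derivative (snd c \<circ> chart_inv d) (at (snd d q)))
      (at ((snd d \<circ> chart_inv c) (snd c q)))"
    unfolding comp_apply chart_inv_chart[OF assms(1,3)]
    by (rule smooth_on_has_derivative[of "snd c \<circ> chart_inv d" "snd d ` (fst d \<inter> fst c)", unfolded comp_def])
      (use atlas assms in \<open>auto simp: smooth_atlas_def comp_def\<close>)
  have "(((snd c \<circ> chart_inv d) \<circ> (snd d \<circ> chart_inv c)) has_derivative
     (frechet_derivative (snd c \<circ> chart_inv d) (at (snd d q)) \<circ>
         frechet_derivative (snd d \<circ> chart_inv c) (at (snd c q)))) (at (snd c q))"
    by (rule diff_chain_at[OF 1 2])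
  then have "((\<lambda>x. x) has_derivative
     (frechet_derivative (snd c \<circ> chart_inv d) (at (snd d q)) \<circ>
         frechet_derivative (snd d \<circ> chart_inv c) (at (snd c q)))) (at (snd c q))"
  proof (rule has_derivative_transform_within_open[OF _ open_overlap_image[OF assms(1,2)]])
    show "snd c q \<in> snd c ` (fst c \<inter> fst d)" using assms by auto
  qed (auto simp: chart_inv_chart assms)
  then show ?thesis using has_derivative_ident has_derivative_unique unfolding id_def by blast
qed

lemma linear_to_tangent:
  assumes "c \<in> A" "q \<in> fst c" shows "linear (to_tangent A c q)"
  unfolding to_tangent_def
  by (rule has_derivative_linear, rule smooth_on_has_derivative[of _ "snd c ` (fst c \<inter> fst (chart_at A q))"])
    (use atlas assms chart_at_in_atlas point_in_chart_at in \<open>auto simp: smooth_atlas_def\<close>)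

lemma to_of_tangent:
  assumes "c \<in> A" "q \<in> fst c" shows "to_tangent A c q (of_tangent A c q v) = v"
  using transition_inverse[OF chart_at_in_atlas assms(1) point_in_chart_at assms(2)]
  by (auto simp: to_tangent_def of_tangent_def coord_at_def fun_eq_iff)

text \<open>Holds at \<open>p\<close> itself only: at a nearby point another chart may be selected.
  Hence undifferentiated components at \<open>coord_at A p\<close> can be replaced by the tensors,
  but only after differentiation.\<close>

lemma to_tangent_self: "to_tangent A (chart_at A p) p = id"
proof -
  let ?c = "chart_at A p"
  have "((\<lambda>x. x) has_derivative (\<lambda>x. x)) (at (snd ?c p))" by simp
  then have "((snd ?c \<circ> chart_inv ?c) has_derivative (\<lambda>x. x)) (at (snd ?c p))"
    by (rule has_derivative_transform_within_open[where s = "chart_image ?c"])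
     (auto simp: open_chart_image chart_at_in_atlas chart_image_mem point_in_chart_at chart_chart_inv)
  then show ?thesis unfolding to_tangent_def id_def by (metis frechet_derivative_at)
qed

lemma chart_inv_coord_at: "chart_inv (chart_at A p) (coord_at A p) = p"
  by (simp add: coord_at_def chart_inv_chart chart_at_in_atlas point_in_chart_at)

lemma coord_at_mem: "coord_at A p \<in> chart_image (chart_at A p)"
  by (simp add: coord_at_def chart_image_mem point_in_chart_at)

lemma of_tangent_self: "of_tangent A (chart_at A p) p v = v"
  using to_of_tangent[OF chart_at_in_atlas point_in_chart_at, of p v] by (simp add: to_tangent_self)

lemma of_to_tangent:
  assumes "c \<in> A" "q \<in> fst c" shows "of_tangent A c q (to_tangent A c q v) = v"
  using transition_inverse[OF assms(1) chart_at_in_atlas assms(2) point_in_chart_at]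
  by (auto simp: to_tangent_def of_tangent_def coord_at_def fun_eq_iff)

end

section \<open>Cosymplectic structures are parallel: pointwise algebra\<close>

locale almost_contact_vector_space =
  fixes G :: "'e::real_vector \<Rightarrow> 'e \<Rightarrow> real" and F :: "'e \<Rightarrow> 'e" and h :: "'e \<Rightarrow> real" and \<xi> :: 'e
  assumes bil: "bilinear G" and sym: "G u v = G v u"
    and linF: "linear F" and linh: "linear h"
    and FF: "F (F u) = - u + h u *\<^sub>R \<xi>" and h\<xi>: "h \<xi> = 1" and F\<xi>: "F \<xi> = 0" and hF: "h (F u) = 0"
    and compat: "G (F u) (F v) = G u v - h u * h v"
begin

lemmas G_linear = bilinear_ladd[OF bil] bilinear_radd[OF bil] bilinear_lneg[OF bil] bilinear_rneg[OF bil]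
  bilinear_lsub[OF bil] bilinear_rsub[OF bil] bilinear_lmul[OF bil] bilinear_rmul[OF bil]
  bilinear_lzero[OF bil] bilinear_rzero[OF bil]

lemmas F_linear = linear_add[OF linF] linear_diff[OF linF] linear_neg[OF linF] linear_scale[OF linF]
  linear_0[OF linF]

lemma G_xi: "G \<xi> v = h v"
  using compat[of \<xi> v] by (simp add: F\<xi> h\<xi> G_linear)

lemma F_skew: "G (F u) v = - G u (F v)"
proof -
  have "G (F (F u)) (F v) = G (F u) v" using compat[of "F u" v] by (simp add: hF)
  then show ?thesis by (simp add: FF G_linear G_xi hF)
qed

lemma Phi_skew: "G u (F v) = - G v (F u)"
  using F_skew[of v u] by (simp add: sym[of u "F v"])

end

text \<open>The prefix \<open>d\<close> marks derivatives of components in a chart, with the direction as first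
  argument; \<open>\<Gamma>\<close> is the Christoffel symbol.\<close>

locale cosymplectic_jet = almost_contact_vector_space G F h \<xi>
  for G :: "'e::real_vector \<Rightarrow> 'e \<Rightarrow> real" and F h \<xi> +
  fixes dG d\<Phi> :: "'e \<Rightarrow> 'e \<Rightarrow> 'e \<Rightarrow> real" and dF :: "'e \<Rightarrow> 'e \<Rightarrow> 'e" and dh :: "'e \<Rightarrow> 'e \<Rightarrow> real"
    and \<Gamma> :: "'e \<Rightarrow> 'e \<Rightarrow> 'e"
  assumes lindF: "linear (\<lambda>w. dF w v)" and lind\<Gamma>: "linear (\<lambda>w. \<Gamma> w v)"
    and torsion_free: "\<Gamma> u v = \<Gamma> v u"
    and metric: "dG w u v = G (\<Gamma> w u) v + G u (\<Gamma> w v)"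
    and d\<Phi>_def: "d\<Phi> w u v = dG w u (F v) + G u (dF w v)"
    and d\<Phi>_skew: "d\<Phi> w u v = - d\<Phi> w v u"
    and d_compat: "dG w (F u) (F v) + G (dF w u) (F v) + G (F u) (dF w v)
      = dG w u v - dh w u * h v - h u * dh w v"
    and closed_h: "dh u v = dh v u"
    and closed_\<Phi>: "d\<Phi> u v w - d\<Phi> v u w + d\<Phi> w u v = 0"
    and integrable: "dF (F u) v - dF (F v) u + F (dF v u) - F (dF u v) = 0"
begin

text \<open>\<open>T\<close> and \<open>H\<close> are the covariant derivatives of \<Phi> and
  \<eta>: \<open>T w u v\<close> is (\<nabla>_w \<Phi>)(u, v) and \<open>H w u\<close> is
  (\<nabla>_w \<eta>)(u).\<close>

definition T where "T w u v = d\<Phi> w u v - G (\<Gamma> w u) (F v) - G u (F (\<Gamma> w v))"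
definition H where "H w u = dh w u - h (\<Gamma> w u)"

text \<open>The other reading of \<open>T\<close>, as G u ((\<nabla>_w F) v): metric compatibility
  trades the derivative of \<open>G\<close> for Christoffel terms.\<close>

lemma T_alt: "T w u v = G u (dF w v) + G u (\<Gamma> w (F v)) - G u (F (\<Gamma> w v))"
  by (simp add: T_def d\<Phi>_def metric)

lemma H_sym: "H w u = H u w"
  by (simp add: H_def closed_h[of w u] torsion_free[of w u])

lemma T_skew: "T w u v = - T w v u"
  using d\<Phi>_skew[of w u v] Phi_skew[of "\<Gamma> w u" v] Phi_skew[of "\<Gamma> w v" u]
  by (simp add: T_def)

lemma T_linear1: "linear (\<lambda>w. T w u v)"
  unfolding T_alt
  by (rule linearI) (simp_all add: linear_add[OF lindF] linear_add[OF lind\<Gamma>] linear_scale[OF lindF]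
     linear_scale[OF lind\<Gamma>] F_linear G_linear algebra_simps)

lemma T_linear2: "linear (\<lambda>u. T w u v)"
  unfolding T_alt by (rule linearI) (simp_all add: G_linear algebra_simps)

text \<open>Obtained from the second slot by skewness, as the locale states linearity of
  \<open>dF\<close> in the direction only.\<close>

lemma T_linear3: "linear (\<lambda>v. T w u v)"
proof -
  have "T w u = (\<lambda>v. - T w v u)" by (rule ext) (rule T_skew)
  then show ?thesis using linear_compose_neg[OF T_linear2] by metis
qed

text \<open>Covariant derivative of the compatibility law \<open>compat\<close>; the terms in
  \<open>H\<close> come from differentiating the product of the two values of
  \<open>h\<close>.\<close>

lemma T_compat: "T w u (F v) = T w (F u) v + H w v * h u + H w u * h v"
proof -
  have a: "T w (F v) u = - T w u (F v)" by (rule T_skew)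
  have "T w (F v) u + T w (F u) v = - H w u * h v - H w v * h u"
    using d_compat[of w u v] sym[of "F v" "dF w u"] sym[of "F v" "\<Gamma> w (F u)"]
      compat[of v "\<Gamma> w u"] compat[of u "\<Gamma> w v"] sym[of v "\<Gamma> w u"]
    unfolding T_alt metric H_def by (simp add: algebra_simps)
  then show ?thesis using a by simp
qed

text \<open>For a torsion-free connection the exterior derivative of \<Phi> is the cyclic sum of its
  covariant derivative, so this is closedness of \<Phi>.\<close>

lemma T_cyclic: "T u v w + T v w u + T w u v = 0"
  using closed_\<Phi>[of u v w] d\<Phi>_skew[of v u w] Phi_skew[of v "\<Gamma> w u"] Phi_skew[of w "\<Gamma> u v"]
    Phi_skew[of u "\<Gamma> v w"]
  by (simp add: T_def torsion_free[of v u] torsion_free[of w v] torsion_free[of u w])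

text \<open>The Nijenhuis torsion paired with \<open>z\<close>. Torsion-freeness lets covariant
  derivatives replace the coordinate derivatives of \<open>F\<close>, and skewness of
  \<open>F\<close> moves it onto \<open>z\<close>.\<close>

lemma T_integrable: "T (F u) z v - T (F v) z u - T v (F z) u + T u (F z) v = 0"
proof -
  have "G z (dF (F u) v - dF (F v) u + F (dF v u) - F (dF u v)) = 0"
    by (simp add: integrable G_linear)
  then show ?thesis
    unfolding T_alt
    by (simp add: F_skew G_linear FF torsion_free[of "F v" "F u"]
        torsion_free[of "F v" u] torsion_free[of v "F u"] torsion_free[of v u] F_linear algebra_simps)
qed

lemma H_xi: "H w \<xi> = 0"
  using T_compat[of w \<xi> \<xi>] by (simp add: F\<xi> h\<xi> linear_0[OF T_linear2] linear_0[OF T_linear3])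

text \<open>Expresses the derivative of \<eta> through that of \<Phi>, so that killing
  \<open>T\<close> settles both.\<close>

lemma H_eq_T: "H w u = - T w (F u) \<xi>"
  using T_compat[of w u \<xi>] by (simp add: F\<xi> h\<xi> H_xi linear_0[OF T_linear3])

text \<open>The left side is symmetric in \<open>u\<close> and \<open>v\<close> by integrability and, up to terms in \<open>H\<close>,
  skew in \<open>z\<close> and \<open>v\<close>; without these terms it would vanish.\<close>

lemma T_F_first: "T (F u) z v + T u (F z) v = - H u v * h z"
proof -
  define S where "S u z v = T (F u) z v + T u (F z) v" for u z v
  have 1: "S u z v = S v z u" for u z v using T_integrable[of u z v] by (simp add: S_def)
  have 2: "S u z v = - S u v z - (H u v * h z + H u z * h v)" for u z v
    using T_compat[of u z v] T_skew[of u "F v" z] T_skew[of "F u" v z]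
    by (simp add: S_def)
  have "S v z u = - S v u z - (H u v * h z + H v z * h u)"
    using 2[of v z u] by (simp only: H_sym[of v u])
  moreover have "S z u v = - S z v u - (H v z * h u + H u z * h v)"
    using 2[of z u v] by (simp only: H_sym[of z v] H_sym[of z u])
  \<comment> \<open>Alternating the two symmetries runs through all six orders of the arguments and
    returns with three sign changes, so twice \<open>S u z v\<close> is a sum of terms in
    \<open>H\<close>, of which only \<open>- 2 * H u v * h z\<close> survives.\<close>
  ultimately have "S u z v = - H u v * h z"
    using 1[of u z v] 1[of v u z] 1[of z v u] 2[of u v z] by linarith
  then show ?thesis by (simp add: S_def)
qed

lemma T_F_zero: "T (F w) u v = 0"
proof -
  have U: "T (F w) u v = T (F u) v w + T (F v) w u" for w u v
  proof -
    have "T u v (F w) = - T (F u) v w + h w * H u v"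
      using T_compat[of u v w] T_F_first[of u v w] by simp
    moreover have "T v (F w) u = - T (F v) w u - H v u * h w"
      using T_F_first[of v w u] by simp
    ultimately show ?thesis using T_cyclic[of "F w" u v] H_sym[of u v] by simp
  qed
  \<comment> \<open>The three cyclic values satisfy a = b + c, b = c + a and c = a + b, hence all
    are zero.\<close>
  show ?thesis using U[of w u v] U[of u v w] U[of v w u] by linarith
qed

text \<open>On the image of \<open>F\<close> the first slot is already dead, and \<open>F\<close>
  applied twice is minus the identity up to \<xi>, so only the direction \<xi> is left. The cyclic
  identity moves that \<xi> into the other slots, where symmetry of \<open>H\<close> and
  \<open>H_xi\<close> kill it.\<close>

lemma T_zero: "T w u v = 0"
proof -
  have e: "T w u v = h w * T \<xi> u v" for w u v
  proof -
    have "T (F (F w)) u v = 0" by (rule T_F_zero)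
    then show ?thesis
      by (simp add: FF linear_add[OF T_linear1] linear_diff[OF T_linear1] linear_scale[OF T_linear1])
  qed
  have a: "T \<xi> (F v) \<xi> = 0" for v
    using H_eq_T[of \<xi> v] H_sym[of \<xi> v] H_xi by simp
  have b: "T \<xi> v \<xi> = 0" for v
    using a[of "F v"] T_skew[of \<xi> \<xi> \<xi>]
    by (simp add: FF linear_add[OF T_linear2] linear_diff[OF T_linear2] linear_scale[OF T_linear2])
  have "T u v \<xi> = 0" unfolding e[of u v \<xi>] by (simp add: b)
  moreover have "T v \<xi> u = 0" unfolding e[of v \<xi> u] by (simp add: b T_skew[of \<xi> \<xi> u])
  ultimately have "T \<xi> u v = 0"
    using T_cyclic[of \<xi> u v] by linarith
  then show ?thesis unfolding e[of w u v] by simp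
qed

lemma fundamental_form_parallel: "d\<Phi> w u v = G (\<Gamma> w u) (F v) + G u (F (\<Gamma> w v))"
  using T_zero[of w u v] by (simp add: T_def)

lemma contact_form_parallel: "dh w u = h (\<Gamma> w u)"
  using H_eq_T[of w u] by (simp add: T_zero H_def)

end

section \<open>The Levi-Civita connection in a chart\<close>

lemma bilinear_expand:
  fixes B :: "'e::euclidean_space \<Rightarrow> 'e \<Rightarrow> real"
  assumes "bilinear B"
  shows "B u v = (\<Sum>i\<in>Basis. \<Sum>j\<in>Basis. (u \<bullet> i) * (v \<bullet> j) * B i j)"
proof -
  have "B u v = B (\<Sum>i\<in>Basis. (u \<bullet> i) *\<^sub>R i) (\<Sum>j\<in>Basis. (v \<bullet> j) *\<^sub>R j)"
    by (simp add: euclidean_representation)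
  also have "\<dots> = (\<Sum>i\<in>Basis. \<Sum>j\<in>Basis. (u \<bullet> i) * (v \<bullet> j) * B i j)"
    by (simp only: bilinear_sum[OF assms] sum.cartesian_product[symmetric] bilinear_lmul[OF assms]
        bilinear_rmul[OF assms] real_scaleR_def mult.assoc mult.left_commute)
  finally show ?thesis .
qed

definition metric_deriv ::
  "('a, 'e::euclidean_space) chart set \<Rightarrow> ('a, 'e) bilin \<Rightarrow> 'a \<Rightarrow> 'e \<Rightarrow> 'e \<Rightarrow> 'e \<Rightarrow> real" where
  "metric_deriv A g p w u v =
     frechet_derivative (\<lambda>x. bilin_rep A (chart_at A p) g x u v) (at (coord_at A p)) w"

context
  fixes A :: "('a::topological_space, 'e::euclidean_space) chart set" and g :: "('a, 'e) bilin"
  assumes atlas: "smooth_atlas A" and metric_g: "riemannian_metric A g"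
begin

lemma metric_bilinear: "bilinear (g p)" and metric_sym: "g p u v = g p v u"
  and metric_pos: "u \<noteq> 0 \<Longrightarrow> g p u u > 0"
  using metric_g by (auto simp: riemannian_metric_def)

lemmas metric_linear = bilinear_ladd[OF metric_bilinear] bilinear_radd[OF metric_bilinear]
  bilinear_lsub[OF metric_bilinear] bilinear_rsub[OF metric_bilinear]
  bilinear_lmul[OF metric_bilinear] bilinear_rmul[OF metric_bilinear]
  bilinear_lzero[OF metric_bilinear] bilinear_rzero[OF metric_bilinear]

lemma metric_nondegenerate: "(\<And>w. g p z w = g p z' w) \<Longrightarrow> z = z'"
  using metric_pos[of "z - z'" p] by (fastforce simp: metric_linear)

text \<open>Riesz representation for \<open>g p\<close>: the map \<open>J\<close>, which lowers
  indices, is injective by nondegeneracy and therefore surjective by dimension.\<close>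

lemma metric_represents:
  assumes "linear f" obtains z where "\<And>w. g p z w = f w"
proof -
  define J where "J z = (\<Sum>b\<in>Basis. g p z b *\<^sub>R b)" for z
  have Jb: "J z \<bullet> b = g p z b" if "b \<in> Basis" for z b using that by (simp add: J_def)
  have lin: "linear J"
    unfolding J_def by (rule linearI)
      (simp_all add: metric_linear scaleR_add_left sum.distrib scaleR_sum_right)
  have "inj J"
  proof (rule injI)
    fix z z' assume "J z = J z'"
    then have eq: "g p z b = g p z' b" if "b \<in> Basis" for b using Jb that by metis
    have "g p z w = g p z' w" for w
      unfolding bilinear_expand[OF metric_bilinear, of p z w] bilinear_expand[OF metric_bilinear, of p z' w]
    proof -
      have "(\<Sum>i\<in>Basis. \<Sum>j\<in>Basis. (y \<bullet> i) * (w \<bullet> j) * g p i j) = (\<Sum>b\<in>Basis. (w \<bullet> b) * g p y b)" for y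
      proof -
        have "(\<Sum>b\<in>Basis. (w \<bullet> b) * g p y b) = g p y (\<Sum>b\<in>Basis. (w \<bullet> b) *\<^sub>R b)"
          using linear_sum[of "g p y" "\<lambda>b. (w \<bullet> b) *\<^sub>R b" Basis] metric_bilinear[of p]
          by (simp add: bilinear_def metric_linear)
        then show ?thesis using bilinear_expand[OF metric_bilinear, of p y w]
          by (simp add: euclidean_representation)
      qed
      then show "(\<Sum>i\<in>Basis. \<Sum>j\<in>Basis. (z \<bullet> i) * (w \<bullet> j) * g p i j) =
        (\<Sum>i\<in>Basis. \<Sum>j\<in>Basis. (z' \<bullet> i) * (w \<bullet> j) * g p i j)" using eq by simp
    qed
    then show "z = z'" by (rule metric_nondegenerate)
  qed
  then have "surj J" using lin linear_injective_imp_surjective by blast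
  then obtain z where z: "J z = (\<Sum>b\<in>Basis. f b *\<^sub>R b)" by (metis surjD)
  have eq: "g p z b = f b" if "b \<in> Basis" for b using that Jb[of b z] z by simp
  have "g p z w = f w" for w
  proof -
    have "g p z w = g p z (\<Sum>b\<in>Basis. (w \<bullet> b) *\<^sub>R b)" by (simp add: euclidean_representation)
    also have "\<dots> = (\<Sum>b\<in>Basis. (w \<bullet> b) * g p z b)"
      using linear_sum[of "g p z" "\<lambda>b. (w \<bullet> b) *\<^sub>R b" Basis] metric_bilinear[of p]
      by (simp add: bilinear_def metric_linear)
    also have "\<dots> = f (\<Sum>b\<in>Basis. (w \<bullet> b) *\<^sub>R b)"
      using eq by (simp add: linear_sum[OF assms] linear_scale[OF assms])
    finally show ?thesis by (simp add: euclidean_representation)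
  qed
  then show ?thesis using that by blast
qed

lemma smooth_metric_rep: "c \<in> A \<Longrightarrow> smooth_on (\<lambda>x. bilin_rep A c g x u v) (chart_image c)"
  using metric_g by (auto simp: riemannian_metric_def)

lemma bilinear_metric_rep:
  assumes "c \<in> A" "x \<in> chart_image c" shows "bilinear (bilin_rep A c g x)"
proof -
  have "linear (to_tangent A c (chart_inv c x))"
    using linear_to_tangent[OF atlas assms(1) chart_inv_in[OF atlas assms]] .
  then show ?thesis
    unfolding bilin_rep_def Let_def bilinear_def
    by (auto intro!: linearI simp: linear_add linear_scale metric_linear)
qed

lemma metric_rep_at: "bilin_rep A (chart_at A p) g (coord_at A p) = g p"
  by (simp add: fun_eq_iff bilin_rep_def chart_inv_coord_at[OF atlas] to_tangent_self[OF atlas])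

lemma has_derivative_metric_rep_basic:
  "((\<lambda>x. bilin_rep A (chart_at A p) g x u v) has_derivative (\<lambda>w. metric_deriv A g p w u v)) (at (coord_at A p))"
  unfolding metric_deriv_def
  by (rule smooth_on_has_derivative[OF smooth_metric_rep[OF chart_at_in_atlas[OF atlas]] coord_at_mem[OF atlas]])

text \<open>Product rule with both arguments moving. The derivative of the metric stays expanded in
  the basis because bilinearity of \<open>metric_deriv\<close> is not yet known; constant arguments
  in this very formula give it.\<close>

lemma has_derivative_metric_rep_expanded:
  assumes f: "(f has_derivative f') (at (coord_at A p))" and k: "(k has_derivative k') (at (coord_at A p))"
  shows "((\<lambda>x. bilin_rep A (chart_at A p) g x (f x) (k x)) has_derivative
    (\<lambda>w. (\<Sum>i\<in>Basis. \<Sum>j\<in>Basis. (f (coord_at A p) \<bullet> i) * (k (coord_at A p) \<bullet> j) * metric_deriv A g p w i j)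
      + g p (f' w) (k (coord_at A p)) + g p (f (coord_at A p)) (k' w))) (at (coord_at A p))"
proof -
  let ?c = "chart_at A p" and ?x = "coord_at A p"
  have "((\<lambda>x. \<Sum>i\<in>Basis. \<Sum>j\<in>Basis. (f x \<bullet> i) * (k x \<bullet> j) * bilin_rep A ?c g x i j) has_derivative
    (\<lambda>w. \<Sum>i\<in>Basis. \<Sum>j\<in>Basis. (f ?x \<bullet> i) * (k ?x \<bullet> j) * metric_deriv A g p w i j +
       ((f ?x \<bullet> i) * (k' w \<bullet> j) + (f' w \<bullet> i) * (k ?x \<bullet> j)) * bilin_rep A ?c g ?x i j)) (at ?x)"
    by (intro has_derivative_sum has_derivative_mult has_derivative_inner_left f k
         has_derivative_metric_rep_basic)
  then have "((\<lambda>x. bilin_rep A (chart_at A p) g x (f x) (k x)) has_derivative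
    (\<lambda>w. \<Sum>i\<in>Basis. \<Sum>j\<in>Basis. (f ?x \<bullet> i) * (k ?x \<bullet> j) * metric_deriv A g p w i j +
       ((f ?x \<bullet> i) * (k' w \<bullet> j) + (f' w \<bullet> i) * (k ?x \<bullet> j)) * bilin_rep A ?c g ?x i j)) (at ?x)"
    by (rule has_derivative_transform_within_open[OF _ open_chart_image[OF atlas chart_at_in_atlas[OF atlas]]
          coord_at_mem[OF atlas]])
      (rule bilinear_expand[OF bilinear_metric_rep[OF chart_at_in_atlas[OF atlas]], symmetric])
  then show ?thesis
    unfolding metric_rep_at bilinear_expand[OF metric_bilinear, of p "f' _"]
      bilinear_expand[OF metric_bilinear, of p "f ?x" "k' _"]
    by (simp add: sum.distrib algebra_simps)
qed

lemma metric_deriv_expand: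
  "metric_deriv A g p w u v = (\<Sum>i\<in>Basis. \<Sum>j\<in>Basis. (u \<bullet> i) * (v \<bullet> j) * metric_deriv A g p w i j)"
  using fun_cong[OF has_derivative_unique[OF has_derivative_metric_rep_basic
    has_derivative_metric_rep_expanded[OF has_derivative_const[of u] has_derivative_const[of v]]], of p w]
  by (simp only: metric_linear add_0_right)

lemma has_derivative_metric_rep:
  assumes f: "(f has_derivative f') (at (coord_at A p))" and k: "(k has_derivative k') (at (coord_at A p))"
  shows "((\<lambda>x. bilin_rep A (chart_at A p) g x (f x) (k x)) has_derivative
    (\<lambda>w. metric_deriv A g p w (f (coord_at A p)) (k (coord_at A p))
      + g p (f' w) (k (coord_at A p)) + g p (f (coord_at A p)) (k' w))) (at (coord_at A p))"
  using has_derivative_metric_rep_expanded[OF assms]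
  unfolding metric_deriv_expand[of p _ "f _" "k _"] .

lemma bilinear_metric_deriv: "bilinear (metric_deriv A g p w)"
proof -
  have e: "metric_deriv A g p w = (\<lambda>u v. \<Sum>i\<in>Basis. \<Sum>j\<in>Basis. (u \<bullet> i) * (v \<bullet> j) * metric_deriv A g p w i j)"
    by (rule ext)+ (rule metric_deriv_expand)
  show ?thesis
    by (subst e) (auto simp: bilinear_def inner_add_left sum.distrib sum_distrib_left algebra_simps intro!: linearI)
qed

lemma linear_metric_deriv: "linear (\<lambda>w. metric_deriv A g p w u v)"
  by (rule has_derivative_linear[OF has_derivative_metric_rep_basic])

lemma metric_deriv_sym: "metric_deriv A g p w u v = metric_deriv A g p w v u"
proof -
  have "bilin_rep A c g x u v = bilin_rep A c g x v u" for c x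
    unfolding bilin_rep_def Let_def by (rule metric_sym)
  then show ?thesis by (simp only: metric_deriv_def)
qed

text \<open>Justifies the definite description in \<open>christoffel\<close>: the Koszul expression
  is linear in \<open>w\<close>, so exactly one vector represents it.\<close>

lemma christoffel_metric:
  "2 * g p (christoffel A g p u v) w
    = metric_deriv A g p u v w + metric_deriv A g p v u w - metric_deriv A g p w u v"
proof -
  let ?f = "\<lambda>w. (metric_deriv A g p u v w + metric_deriv A g p v u w - metric_deriv A g p w u v) / 2"
  have "linear (metric_deriv A g p u v)" "linear (metric_deriv A g p v u)"
    using bilinear_metric_deriv by (auto simp: bilinear_def)
  then have "linear ?f"
    by (intro linearI) (simp_all add: linear_add linear_scale linear_add[OF linear_metric_deriv]
      linear_scale[OF linear_metric_deriv] field_simps)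
  then obtain z where z: "\<And>w. g p z w = ?f w" using metric_represents by blast
  let ?P = "\<lambda>z. \<forall>w. 2 * g p z w = metric_deriv A g p u v w + metric_deriv A g p v u w - metric_deriv A g p w u v"
  have "?P (THE z. ?P z)"
  proof (rule theI)
    show "?P z" by (simp add: z)
    fix z' assume z': "?P z'"
    show "z' = z"
    proof (rule metric_nondegenerate)
      fix w show "g p z' w = g p z w" using z'[rule_format, of w] z[of w] by simp
    qed
  qed
  then show ?thesis by (simp add: christoffel_def metric_deriv_def)
qed

lemma christoffel_sym: "christoffel A g p u v = christoffel A g p v u"
proof (rule metric_nondegenerate)
  fix w show "g p (christoffel A g p u v) w = g p (christoffel A g p v u) w"
    using christoffel_metric[of p u v w] christoffel_metric[of p v u w] metric_deriv_sym[of p w u v] by linarith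
qed

lemma linear_christoffel: "linear (\<lambda>u. christoffel A g p u v)"
proof (rule linearI; rule metric_nondegenerate)
  fix u u' w r
  have l: "linear (\<lambda>u. metric_deriv A g p v u w)" "linear (\<lambda>u. metric_deriv A g p w u v)"
    using bilinear_metric_deriv by (auto simp: bilinear_def)
  have s: "g p (a + b) w = g p a w + g p b w" "g p (r *\<^sub>R a) w = r * g p a w" for a b
    by (simp_all add: metric_linear)
  show "g p (christoffel A g p (u + u') v) w = g p (christoffel A g p u v + christoffel A g p u' v) w"
    using christoffel_metric[of p "u + u'" v w] christoffel_metric[of p u v w] christoffel_metric[of p u' v w]
    unfolding s linear_add[OF linear_metric_deriv] linear_add[OF l(1)] linear_add[OF l(2)] by argo
  have "2 * g p (christoffel A g p (r *\<^sub>R u) v) w = r * (2 * g p (christoffel A g p u v) w)"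
    unfolding christoffel_metric linear_scale[OF linear_metric_deriv] linear_scale[OF l(1)]
      linear_scale[OF l(2)] by (simp add: algebra_simps)
  then show "g p (christoffel A g p (r *\<^sub>R u) v) w = g p (r *\<^sub>R christoffel A g p u v) w"
    unfolding s by simp
qed

text \<open>In the sum of two Koszul formulas the derivatives in the directions \<open>u\<close> and
  \<open>v\<close> cancel.\<close>

lemma christoffel_compatible:
  "metric_deriv A g p w u v = g p (christoffel A g p w u) v + g p u (christoffel A g p w v)"
  using christoffel_metric[of p w u v] christoffel_metric[of p w v u] metric_deriv_sym[of p w u v]
    metric_deriv_sym[of p u w v] metric_deriv_sym[of p v w u] metric_sym[of p u "christoffel A g p w v"]
  by linarith

end

section \<open>Parallelism of cosymplectic structures\<close>

lemma linear_alternating_1: "alternating 1 \<alpha> \<Longrightarrow> linear (\<lambda>u. \<alpha> [u])"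
proof -
  assume "alternating 1 \<alpha>"
  then have "\<forall>vs i. length vs = 1 \<and> i < 1 \<longrightarrow> linear (\<lambda>v. \<alpha> (vs[i := v]))" unfolding alternating_def by blast
  from this[rule_format, of "[0]" 0] show ?thesis by simp
qed

context
  fixes A :: "('a::topological_space, 'e::euclidean_space) chart set" and g :: "('a, 'e) bilin"
    and \<phi> :: "('a, 'e) endo" and \<xi> :: "('a, 'e) vfield" and \<eta> :: "('a, 'e) form"
  assumes atlas: "smooth_atlas A" and cos: "cosymplectic A \<phi> \<xi> \<eta> g"
    and phi_xi: "\<And>p. \<phi> p (\<xi> p) = 0" and eta_phi: "\<And>p u. \<eta> p [\<phi> p u] = 0"
begin

lemma cosymplectic_metric: "riemannian_metric A g"
  using cos by (simp add: cosymplectic_def almost_contact_metric_def)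

lemma smooth_form_rep: "c \<in> A \<Longrightarrow> smooth_on (\<lambda>x. form_rep A c \<eta> x vs) (chart_image c)"
  using cos by (auto simp: cosymplectic_def almost_contact_metric_def forms_def)

lemma smooth_endo_rep: "c \<in> A \<Longrightarrow> smooth_on (\<lambda>x. endo_rep A c \<phi> x v) (chart_image c)"
  using cos by (auto simp: cosymplectic_def almost_contact_metric_def smooth_endo_def)

lemma almost_contact_at: "almost_contact_vector_space (g p) (\<phi> p) (\<lambda>u. \<eta> p [u]) (\<xi> p)"
proof (rule almost_contact_vector_space.intro)
  show "bilinear (g p)" using metric_bilinear[OF atlas cosymplectic_metric] .
  show "g p u v = g p v u" for u v using metric_sym[OF atlas cosymplectic_metric] .
  show "linear (\<lambda>u. \<eta> p [u])"
    using cos by (intro linear_alternating_1) (simp add: cosymplectic_def almost_contact_metric_def forms_def)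
  show "linear (\<phi> p)" and "\<phi> p (\<phi> p u) = - u + \<eta> p [u] *\<^sub>R \<xi> p" and "\<eta> p [\<xi> p] = 1"
    and "g p (\<phi> p u) (\<phi> p v) = g p u v - \<eta> p [u] * \<eta> p [v]" for u v
    using cos
    by (auto simp: cosymplectic_def almost_contact_metric_def smooth_endo_def forms_def)
qed (rule phi_xi eta_phi)+

lemma fundamental_form_rep:
  assumes "c \<in> A" "x \<in> chart_image c"
  shows "form_rep A c (fundamental_form \<phi> g) x [u, v] = bilin_rep A c g x u (endo_rep A c \<phi> x v)"
  using to_of_tangent[OF atlas assms(1) chart_inv_in[OF atlas assms]]
  by (simp add: form_rep_def fundamental_form_def bilin_rep_def endo_rep_def Let_def)

lemma metric_rep_endo_compat:
  assumes "c \<in> A" "x \<in> chart_image c"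
  shows "bilin_rep A c g x (endo_rep A c \<phi> x u) (endo_rep A c \<phi> x v)
    = bilin_rep A c g x u v - form_rep A c \<eta> x [u] * form_rep A c \<eta> x [v]"
  using to_of_tangent[OF atlas assms(1) chart_inv_in[OF atlas assms]]
    almost_contact_vector_space.compat[OF almost_contact_at]
  by (simp add: form_rep_def bilin_rep_def endo_rep_def Let_def)

lemma fundamental_form_rep_skew:
  "form_rep A c (fundamental_form \<phi> g) x [u, v] = - form_rep A c (fundamental_form \<phi> g) x [v, u]"
  using almost_contact_vector_space.Phi_skew[OF almost_contact_at, of "chart_inv c x"
      "to_tangent A c (chart_inv c x) u" "to_tangent A c (chart_inv c x) v"]
  by (simp add: form_rep_def fundamental_form_def Let_def)

lemma smooth_fundamental_form_rep:
  assumes c: "c \<in> A"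
  shows "smooth_on (\<lambda>x. form_rep A c (fundamental_form \<phi> g) x [u, v]) (chart_image c)"
proof -
  have "smooth_on (\<lambda>x. \<Sum>i\<in>Basis. \<Sum>j\<in>Basis. (u \<bullet> i) * (endo_rep A c \<phi> x v \<bullet> j) * bilin_rep A c g x i j)
      (chart_image c)"
    by (intro smooth_on_sum smooth_on_mult smooth_on_inner_left smooth_on_const smooth_endo_rep c
        open_chart_image[OF atlas] smooth_metric_rep[OF atlas cosymplectic_metric])
  then show ?thesis
  proof (rule smooth_on_cong[OF open_chart_image[OF atlas c]])
    fix x assume x: "x \<in> chart_image c"
    show "(\<Sum>i\<in>Basis. \<Sum>j\<in>Basis. (u \<bullet> i) * (endo_rep A c \<phi> x v \<bullet> j) * bilin_rep A c g x i j) =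
       form_rep A c (fundamental_form \<phi> g) x [u, v]"
      unfolding fundamental_form_rep[OF c x]
      by (rule bilinear_expand[OF bilinear_metric_rep[OF atlas cosymplectic_metric c x], symmetric])
  qed
qed

text \<open>Links the fields to the pointwise algebra: each tensor identity holds on the whole image
  of the chart selected at \<open>p\<close>, so its components may be differentiated at
  \<open>x0\<close>, where the chart identification is trivial.\<close>

lemma cosymplectic_jet_at:
  fixes p :: 'a
  defines "c \<equiv> chart_at A p" and "x0 \<equiv> coord_at A p"
  shows "cosymplectic_jet (g p) (\<phi> p) (\<lambda>u. \<eta> p [u]) (\<xi> p) (metric_deriv A g p)
    (\<lambda>w u v. frechet_derivative (\<lambda>x. form_rep A c (fundamental_form \<phi> g) x [u, v]) (at x0) w)
    (\<lambda>w v. frechet_derivative (\<lambda>x. endo_rep A c \<phi> x v) (at x0) w)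
    (\<lambda>w u. frechet_derivative (\<lambda>x. form_rep A c \<eta> x [u]) (at x0) w)
    (christoffel A g p)"
proof -
  interpret almost_contact_vector_space "g p" "\<phi> p" "\<lambda>u. \<eta> p [u]" "\<xi> p"
    by (rule almost_contact_at)
  have c: "c \<in> A" and x0: "x0 \<in> chart_image c" and inv: "chart_inv c x0 = p"
    by (simp_all add: c_def x0_def chart_at_in_atlas[OF atlas] coord_at_mem[OF atlas] chart_inv_coord_at[OF atlas])
  note opn = open_chart_image[OF atlas c]
  have tan: "to_tangent A c p v = v" "of_tangent A c p v = v" for v
    by (simp_all add: c_def to_tangent_self[OF atlas] of_tangent_self[OF atlas])
  have endo0: "endo_rep A c \<phi> x0 v = \<phi> p v" and eta0: "form_rep A c \<eta> x0 [v] = \<eta> p [v]"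
    for v by (simp_all add: endo_rep_def form_rep_def inv tan)
  let ?dF = "\<lambda>w v. frechet_derivative (\<lambda>x. endo_rep A c \<phi> x v) (at x0) w"
  let ?dh = "\<lambda>w u. frechet_derivative (\<lambda>x. form_rep A c \<eta> x [u]) (at x0) w"
  let ?dPhi = "\<lambda>w u v. frechet_derivative (\<lambda>x. form_rep A c (fundamental_form \<phi> g) x [u, v]) (at x0) w"
  have dF: "((\<lambda>x. endo_rep A c \<phi> x v) has_derivative (\<lambda>w. ?dF w v)) (at x0)" for v
    by (rule smooth_on_has_derivative[OF smooth_endo_rep[OF c] x0])
  have dh: "((\<lambda>x. form_rep A c \<eta> x [v]) has_derivative (\<lambda>w. ?dh w v)) (at x0)" for v
    by (rule smooth_on_has_derivative[OF smooth_form_rep[OF c] x0])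
  have dPhi: "((\<lambda>x. form_rep A c (fundamental_form \<phi> g) x [u, v]) has_derivative (\<lambda>w. ?dPhi w u v)) (at x0)"
    for u v by (rule smooth_on_has_derivative[OF smooth_fundamental_form_rep[OF c] x0])
  note dG = has_derivative_metric_rep[OF atlas cosymplectic_metric, of _ _ p, folded c_def x0_def]
  have closed: "ext_deriv A \<eta> p vs = 0" "ext_deriv A (fundamental_form \<phi> g) p vs = 0"
    and torsion: "nijenhuis A \<phi> p u v + (2 * ext_deriv A \<eta> p [u, v]) *\<^sub>R \<xi> p = 0" for vs u v
    using cos unfolding cosymplectic_def by blast+
  show ?thesis
  proof (intro cosymplectic_jet.intro almost_contact_at cosymplectic_jet_axioms.intro)
    show "linear (\<lambda>w. ?dF w v)" for v using dF by (rule has_derivative_linear)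
    show "linear (\<lambda>w. christoffel A g p w v)" for v
      by (rule linear_christoffel[OF atlas cosymplectic_metric])
    show "christoffel A g p u v = christoffel A g p v u" for u v
      by (rule christoffel_sym[OF atlas cosymplectic_metric])
    show "metric_deriv A g p w u v = g p (christoffel A g p w u) v + g p u (christoffel A g p w v)" for w u v
      by (rule christoffel_compatible[OF atlas cosymplectic_metric])
    show "?dPhi w u v = metric_deriv A g p w u (\<phi> p v) + g p u (?dF w v)" for w u v
    proof -
      have "((\<lambda>x. form_rep A c (fundamental_form \<phi> g) x [u, v]) has_derivative
         (\<lambda>w. metric_deriv A g p w u (endo_rep A c \<phi> x0 v) + g p 0 (endo_rep A c \<phi> x0 v) + g p u (?dF w v))) (at x0)"
        using dG[OF has_derivative_const dF[of v], of u]
        by (rule has_derivative_transform_within_open[OF _ opn x0]) (simp add: fundamental_form_rep[OF c])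
      from fun_cong[OF has_derivative_unique[OF dPhi this]] show ?thesis by (simp add: endo0 G_linear)
    qed
    show "?dPhi w u v = - ?dPhi w v u" for w u v
    proof -
      have "((\<lambda>x. form_rep A c (fundamental_form \<phi> g) x [u, v]) has_derivative (\<lambda>w. - ?dPhi w v u)) (at x0)"
        unfolding fundamental_form_rep_skew[of c _ u v] by (rule has_derivative_minus[OF dPhi])
      from fun_cong[OF has_derivative_unique[OF dPhi this]] show ?thesis .
    qed
    show "metric_deriv A g p w (\<phi> p u) (\<phi> p v) + g p (?dF w u) (\<phi> p v) + g p (\<phi> p u) (?dF w v) =
       metric_deriv A g p w u v - ?dh w u * \<eta> p [v] - \<eta> p [u] * ?dh w v" for w u v
    proof -
      \<comment> \<open>\<open>d1\<close> and \<open>d2\<close> differentiate one function in two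
        ways, \<open>d1\<close> through the left side of \<open>metric_rep_endo_compat\<close> and
        \<open>d2\<close> term by term; uniqueness of derivatives equates them.\<close>
      have d1: "((\<lambda>x. bilin_rep A c g x u v - form_rep A c \<eta> x [u] * form_rep A c \<eta> x [v]) has_derivative
         (\<lambda>w. metric_deriv A g p w (endo_rep A c \<phi> x0 u) (endo_rep A c \<phi> x0 v)
           + g p (?dF w u) (endo_rep A c \<phi> x0 v) + g p (endo_rep A c \<phi> x0 u) (?dF w v))) (at x0)"
        using dG[OF dF[of u] dF[of v]]
        by (rule has_derivative_transform_within_open[OF _ opn x0]) (simp add: metric_rep_endo_compat[OF c])
      have d2: "((\<lambda>x. bilin_rep A c g x u v - form_rep A c \<eta> x [u] * form_rep A c \<eta> x [v]) has_derivative
         (\<lambda>w. metric_deriv A g p w u v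
           - (form_rep A c \<eta> x0 [u] * ?dh w v + ?dh w u * form_rep A c \<eta> x0 [v]))) (at x0)"
        by (intro has_derivative_diff has_derivative_mult dh
            has_derivative_metric_rep_basic[OF atlas cosymplectic_metric, of p, folded c_def x0_def])
      from fun_cong[OF has_derivative_unique[OF d1 d2], of w] show ?thesis by (simp add: endo0 eta0)
    qed
    show "?dh u v = ?dh v u" for u v
      using closed(1)[of "[u, v]"] by (simp add: ext_deriv_def numeral_2_eq_2 c_def x0_def)
    show "?dPhi u v w - ?dPhi v u w + ?dPhi w u v = 0" for u v w
      using closed(2)[of "[u, v, w]"] by (simp add: ext_deriv_def numeral_3_eq_3 c_def x0_def)
    show "?dF (\<phi> p u) v - ?dF (\<phi> p v) u + \<phi> p (?dF v u) - \<phi> p (?dF u v) = 0" for u v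
    proof -
      \<comment> \<open>The fields extending \<open>u\<close> and \<open>v\<close> have constant
        components, so their derivatives drop out of all brackets and only derivatives of \<phi>
        remain.\<close>
      have const: "frechet_derivative (vfield_rep A c (\<lambda>q. to_tangent A c q y)) (at x0) w = 0" for y w
      proof -
        have "(vfield_rep A c (\<lambda>q. to_tangent A c q y) has_derivative (\<lambda>w. 0)) (at x0)"
          by (rule has_derivative_transform_within_open[OF has_derivative_const[of y] opn x0])
            (simp add: vfield_rep_def of_to_tangent[OF atlas c chart_inv_in[OF atlas c]])
        then show ?thesis by (metis frechet_derivative_at)
      qed
      have endo: "vfield_rep A c (\<lambda>q. \<phi> q (to_tangent A c q y)) = (\<lambda>x. endo_rep A c \<phi> x y)" for y
        by (simp add: fun_eq_iff vfield_rep_def endo_rep_def)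
      have "nijenhuis A \<phi> p u v = 0" using torsion[of u v] closed by simp
      then show ?thesis
        unfolding nijenhuis_def Let_def lie_bracket_def c_def[symmetric] x0_def[symmetric] const endo tan
        by (simp add: F_linear)
    qed
  qed
qed

lemma has_derivative_fundamental_form_rep:
  "((\<lambda>x. form_rep A (chart_at A p) (fundamental_form \<phi> g) x [u, v]) has_derivative
     (\<lambda>w. g p (christoffel A g p w u) (\<phi> p v) + g p u (\<phi> p (christoffel A g p w v)))) (at (coord_at A p))"
  using smooth_on_has_derivative[OF smooth_fundamental_form_rep[OF chart_at_in_atlas[OF atlas]] coord_at_mem[OF atlas]]
  unfolding cosymplectic_jet.fundamental_form_parallel[OF cosymplectic_jet_at, symmetric] .

lemma has_derivative_contact_form_rep:
  "((\<lambda>x. form_rep A (chart_at A p) \<eta> x [u]) has_derivative (\<lambda>w. \<eta> p [christoffel A g p w u])) (at (coord_at A p))"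
  using smooth_on_has_derivative[OF smooth_form_rep[OF chart_at_in_atlas[OF atlas]] coord_at_mem[OF atlas]]
  unfolding cosymplectic_jet.contact_form_parallel[OF cosymplectic_jet_at, symmetric] .

end

section \<open>Alternating products of bilinear forms\<close>

lemma nth_update_permuted:
  assumes "\<sigma> permutes {..<length vs}" "i < length vs" "m < length vs"
  shows "vs[\<sigma> i := v] ! \<sigma> m = (if m = i then v else vs ! \<sigma> m)"
proof -
  have "\<sigma> i < length vs" "\<sigma> m = \<sigma> i \<longleftrightarrow> m = i"
    using permutes_in_image[OF assms(1)] assms(2) permutes_inj[OF assms(1)] by (auto simp: inj_def)
  then show ?thesis by (auto simp: nth_list_update)
qed

text \<open>Up to normalisation, the wedge product of the 2-forms \<open>B 0, \<dots>, B (k - 1)\<close>.\<close>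

definition pair_form :: "nat \<Rightarrow> (nat \<Rightarrow> 'e \<Rightarrow> 'e \<Rightarrow> real) \<Rightarrow> 'e list \<Rightarrow> real" where
  "pair_form k B vs = (if length vs = 2 * k
     then \<Sum>\<sigma> | \<sigma> permutes {..<2 * k}. of_int (sign \<sigma>) * (\<Prod>m<k. B m (vs ! \<sigma> (2 * m)) (vs ! \<sigma> (2 * m + 1)))
     else 0)"

lemma permuted_pair_index:
  fixes k m :: nat
  assumes "\<sigma> permutes {..<2 * k}" "m < k"
  shows "\<sigma> (2 * m) < 2 * k" "\<sigma> (2 * m + 1) < 2 * k" "\<sigma> (2 * m) \<noteq> \<sigma> (2 * m + 1)"
  using permutes_in_image[OF assms(1), of "2 * m"] permutes_in_image[OF assms(1), of "2 * m + 1"]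
    inj_eq[OF permutes_inj[OF assms(1)], of "2 * m" "2 * m + 1"] assms(2) by auto

text \<open>Composing every permutation with the transposition of \<open>i\<close> and
  \<open>j\<close> changes the signs but not the products, so the sum equals its own
  negative.\<close>

lemma pair_form_equal_args:
  assumes len: "length vs = 2 * k" and ij: "i < j" "j < 2 * k" and eq: "vs ! i = vs ! j"
  shows "pair_form k B vs = 0"
proof -
  define f where "f \<sigma> = of_int (sign \<sigma>) * (\<Prod>m<k. B m (vs ! \<sigma> (2 * m)) (vs ! \<sigma> (2 * m + 1)))" for \<sigma>
  let ?t = "Transposition.transpose i j"
  have t: "?t permutes {..<2 * k}" using ij by (intro permutes_swap_id) auto
  have nth: "vs ! ?t a = vs ! a" for a using eq by (auto simp: Transposition.transpose_def)
  have flip: "f (?t \<circ> \<sigma>) = - f \<sigma>" if "\<sigma> permutes {..<2 * k}" for \<sigma>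
  proof -
    have "sign (?t \<circ> \<sigma>) = - sign \<sigma>"
      using ij that permutation_permutes[of \<sigma>]
      by (auto simp: sign_compose permutation_swap_id sign_swap_id)
    then show ?thesis by (simp add: f_def nth)
  qed
  have "sum f {\<sigma>. \<sigma> permutes {..<2 * k}} = (\<Sum>\<sigma> | \<sigma> permutes {..<2 * k}. f (?t \<circ> \<sigma>))"
    by (rule setum_permutations_compose_left[OF t])
  also have "\<dots> = - sum f {\<sigma>. \<sigma> permutes {..<2 * k}}" using flip by (simp add: sum_negf)
  finally show ?thesis using len by (simp add: pair_form_def f_def)
qed

lemma linear_mult_left: "linear f \<Longrightarrow> linear (\<lambda>v. c * f v)" for f :: "'e::real_vector \<Rightarrow> real"
  by (auto intro!: linearI simp: linear_add linear_scale algebra_simps)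

lemma linear_mult_right: "linear f \<Longrightarrow> linear (\<lambda>v. f v * c)" for f :: "'e::real_vector \<Rightarrow> real"
  by (auto intro!: linearI simp: linear_add linear_scale algebra_simps)

lemma linear_prod_one:
  fixes f :: "'i \<Rightarrow> 'e::real_vector \<Rightarrow> real"
  assumes "finite I" "m \<in> I" "linear (f m)" "\<And>m' v. m' \<in> I \<Longrightarrow> m' \<noteq> m \<Longrightarrow> f m' v = c m'"
  shows "linear (\<lambda>v. \<Prod>m\<in>I. f m v)"
proof -
  have "(\<Prod>m\<in>I. f m v) = f m v * (\<Prod>m\<in>I - {m}. c m)" for v
    using assms by (simp add: prod.remove)
  then show ?thesis
    using assms(3) by (auto intro!: linearI simp: linear_add linear_scale algebra_simps)
qed

lemma alternating_pair_form:
  assumes bil: "\<And>m. m < k \<Longrightarrow> bilinear (B m)"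
  shows "alternating (2 * k) (pair_form k B)"
  unfolding alternating_def
proof (intro conjI allI impI; (elim conjE)?)
  fix vs :: "'a list" and i assume len: "length vs = 2 * k" and i: "i < 2 * k"
  have "linear (\<lambda>v. \<Prod>m<k. B m (vs[i := v] ! \<sigma> (2 * m)) (vs[i := v] ! \<sigma> (2 * m + 1)))"
    if s: "\<sigma> permutes {..<2 * k}" for \<sigma>
  proof -
    \<comment> \<open>Position \<open>i\<close> is read exactly once, at \<open>j\<close>, hence
      only by the factor numbered \<open>j div 2\<close>; parity of \<open>j\<close> tells which of
      its two slots.\<close>
    obtain j where j: "i = \<sigma> j" "j < 2 * k"
      using permutes_surj[OF s] permutes_in_image[OF s] i by (metis lessThan_iff surjD)
    note upd = nth_update_permuted[of \<sigma> vs j, folded j(1), unfolded len, OF s j(2)]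
    show ?thesis
    proof (rule linear_prod_one[where m = "j div 2" and
          c = "\<lambda>m. B m (vs ! \<sigma> (2 * m)) (vs ! \<sigma> (2 * m + 1))"])
      have B: "bilinear (B (j div 2))" using j(2) by (intro bil) auto
      show "linear (\<lambda>v. B (j div 2) (vs[i := v] ! \<sigma> (2 * (j div 2))) (vs[i := v] ! \<sigma> (2 * (j div 2) + 1)))"
      proof (cases "even j")
        case True
        then have "2 * (j div 2) = j" "2 * (j div 2) + 1 < 2 * k" using j(2) by (auto elim!: evenE)
        then show ?thesis using B j(2) by (simp add: upd bilinear_def)
      next
        case False
        then have "2 * (j div 2) + 1 = j" using odd_two_times_div_two_succ by blast
        moreover from this have "2 * (j div 2) < 2 * k" "2 * (j div 2) \<noteq> j" using j(2) by linarith+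
        ultimately show ?thesis using B j(2) by (simp only: upd) (simp add: bilinear_def)
      qed
    next
      fix m v assume "m \<in> {..<k}" "m \<noteq> j div 2"
      then have "2 * m < 2 * k" "2 * m + 1 < 2 * k" "2 * m \<noteq> j" "2 * m + 1 \<noteq> j" by auto
      then show "B m (vs[i := v] ! \<sigma> (2 * m)) (vs[i := v] ! \<sigma> (2 * m + 1)) =
         B m (vs ! \<sigma> (2 * m)) (vs ! \<sigma> (2 * m + 1))" by (simp only: upd if_False)
    qed (use j in auto)
  qed
  note l = this
  have "linear (\<lambda>v. \<Sum>\<sigma> | \<sigma> permutes {..<2 * k}. of_int (sign \<sigma>) *
     (\<Prod>m<k. B m (vs[i := v] ! \<sigma> (2 * m)) (vs[i := v] ! \<sigma> (2 * m + 1))))"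
    by (intro linear_compose_sum ballI linear_mult_left l) auto
  then show "linear (\<lambda>v. pair_form k B (vs[i := v]))"
    by (simp add: pair_form_def len)
qed ((rule pair_form_equal_args; assumption) | simp add: pair_form_def)+

lemma smooth_on_pair_form:
  assumes "open S" "\<And>m u v. m < k \<Longrightarrow> smooth_on (\<lambda>x. B m x u v) S"
  shows "smooth_on (\<lambda>x. pair_form k (\<lambda>m. B m x) vs) S"
  by (cases "length vs = 2 * k")
    (auto simp: pair_form_def intro!: smooth_on_sum smooth_on_mult smooth_on_prod smooth_on_const assms)

lemma pair_form_rep:
  "form_rep A c (\<lambda>p. pair_form k (\<lambda>m. B m p)) x vs = pair_form k (\<lambda>m. bilin_rep A c (B m) x) vs"
  by (auto simp: form_rep_def pair_form_def bilin_rep_def Let_def permuted_pair_index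
     simp del: One_nat_def add_Suc_right intro!: sum.cong prod.cong)

lemma sum_pairs: "(\<Sum>i<2 * k. f i) = (\<Sum>m<k. f (2 * m) + f (2 * m + 1 :: nat))" for f :: "nat \<Rightarrow> real"
  by (induction k) auto

text \<open>Products of parallel forms are parallel: \<Gamma> acts as a derivation on the factors,
  and the sum over factors regroups into a sum over argument positions.\<close>

lemma has_derivative_pair_form:
  fixes B :: "nat \<Rightarrow> 'x::real_normed_vector \<Rightarrow> 'e::real_vector \<Rightarrow> 'e \<Rightarrow> real"
  assumes der: "\<And>m u v. m < k \<Longrightarrow> ((\<lambda>x. B m x u v) has_derivative
      (\<lambda>w. B m x0 (\<Gamma> w u) v + B m x0 u (\<Gamma> w v))) (at x0)"
  shows "((\<lambda>x. pair_form k (\<lambda>m. B m x) vs) has_derivative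
      (\<lambda>w. \<Sum>i<length vs. pair_form k (\<lambda>m. B m x0) (vs[i := \<Gamma> w (vs ! i)]))) (at x0)"
proof (cases "length vs = 2 * k")
  case False
  then show ?thesis by (simp add: pair_form_def)
next
  case len: True
  let ?b = "\<lambda>m \<sigma>. B m x0 (vs ! \<sigma> (2 * m)) (vs ! \<sigma> (2 * m + 1))"
  let ?d = "\<lambda>w m \<sigma>. B m x0 (\<Gamma> w (vs ! \<sigma> (2 * m))) (vs ! \<sigma> (2 * m + 1))
     + B m x0 (vs ! \<sigma> (2 * m)) (\<Gamma> w (vs ! \<sigma> (2 * m + 1)))"
  have eq: "(\<Sum>i<2 * k. \<Prod>m<k. B m x0 (vs[i := \<Gamma> w (vs ! i)] ! \<sigma> (2 * m)) (vs[i := \<Gamma> w (vs ! i)] ! \<sigma> (2 * m + 1)))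
     = (\<Sum>m<k. ?d w m \<sigma> * (\<Prod>m'\<in>{..<k} - {m}. ?b m' \<sigma>))" (is "(\<Sum>i<2 * k. ?P i) = _")
    if s: "\<sigma> permutes {..<2 * k}" for \<sigma> w
  proof -
    note upd = nth_update_permuted[of \<sigma> vs, unfolded len, OF s]
    have P: "?P (\<sigma> j) = (\<Prod>m<k. B m x0 (if 2 * m = j then \<Gamma> w (vs ! \<sigma> j) else vs ! \<sigma> (2 * m))
        (if 2 * m + 1 = j then \<Gamma> w (vs ! \<sigma> j) else vs ! \<sigma> (2 * m + 1)))" if "j < 2 * k" for j
      using that by (intro prod.cong refl) (simp add: upd del: One_nat_def add_Suc_right)
    have split: "(\<Prod>m<k. f m) = f l * (\<Prod>m\<in>{..<k} - {l}. ?b m \<sigma>)"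
      if "l < k" "\<And>m. m \<noteq> l \<Longrightarrow> f m = ?b m \<sigma>" for f l
      using that by (simp add: prod.remove[of _ l])
    have pair: "?P (\<sigma> (2 * l)) + ?P (\<sigma> (2 * l + 1)) = ?d w l \<sigma> * (\<Prod>m\<in>{..<k} - {l}. ?b m \<sigma>)"
      if l: "l < k" for l
    proof -
      have "2 * l < 2 * k" "2 * l + 1 < 2 * k" using l by auto
      note P[OF this(1)] P[OF this(2)]
      moreover have "(\<Prod>m<k. B m x0 (if 2 * m = 2 * l then \<Gamma> w (vs ! \<sigma> (2 * l)) else vs ! \<sigma> (2 * m))
        (if 2 * m + 1 = 2 * l then \<Gamma> w (vs ! \<sigma> (2 * l)) else vs ! \<sigma> (2 * m + 1)))
         = B l x0 (\<Gamma> w (vs ! \<sigma> (2 * l))) (vs ! \<sigma> (2 * l + 1)) * (\<Prod>m\<in>{..<k} - {l}. ?b m \<sigma>)"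
        by (subst split[OF l]) auto
      moreover have "(\<Prod>m<k. B m x0 (if 2 * m = 2 * l + 1 then \<Gamma> w (vs ! \<sigma> (2 * l + 1)) else vs ! \<sigma> (2 * m))
        (if 2 * m + 1 = 2 * l + 1 then \<Gamma> w (vs ! \<sigma> (2 * l + 1)) else vs ! \<sigma> (2 * m + 1)))
         = B l x0 (vs ! \<sigma> (2 * l)) (\<Gamma> w (vs ! \<sigma> (2 * l + 1))) * (\<Prod>m\<in>{..<k} - {l}. ?b m \<sigma>)"
        by (subst split[OF l]) auto
      ultimately show ?thesis by (simp only: distrib_right)
    qed
    \<comment> \<open>Listing the positions as \<sigma> 0, \<sigma> 1, ... puts the two slots of
      each factor next to each other.\<close>
    have "(\<Sum>i<2 * k. ?P i) = (\<Sum>j<2 * k. ?P (\<sigma> j))"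
      using permutes_imp_bij[OF s] by (rule sum.reindex_bij_betw[symmetric])
    also have "\<dots> = (\<Sum>l<k. ?P (\<sigma> (2 * l)) + ?P (\<sigma> (2 * l + 1)))" by (rule sum_pairs)
    finally show ?thesis using pair by simp
  qed
  have "((\<lambda>x. \<Sum>\<sigma> | \<sigma> permutes {..<2 * k}. of_int (sign \<sigma>) *
        (\<Prod>m<k. B m x (vs ! \<sigma> (2 * m)) (vs ! \<sigma> (2 * m + 1)))) has_derivative
     (\<lambda>w. \<Sum>\<sigma> | \<sigma> permutes {..<2 * k}. of_int (sign \<sigma>) *
        (\<Sum>m<k. ?d w m \<sigma> * (\<Prod>m'\<in>{..<k} - {m}. ?b m' \<sigma>)))) (at x0)"
    by (intro has_derivative_sum has_derivative_mult_right has_derivative_prod der) auto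
  moreover have "(\<Sum>\<sigma> | \<sigma> permutes {..<2 * k}. of_int (sign \<sigma>) *
        (\<Sum>m<k. ?d w m \<sigma> * (\<Prod>m'\<in>{..<k} - {m}. ?b m' \<sigma>)))
     = (\<Sum>i<length vs. pair_form k (\<lambda>m. B m x0) (vs[i := \<Gamma> w (vs ! i)]))" for w
  proof -
    let ?P = "\<lambda>\<sigma> i. \<Prod>m<k. B m x0 (vs[i := \<Gamma> w (vs ! i)] ! \<sigma> (2 * m))
        (vs[i := \<Gamma> w (vs ! i)] ! \<sigma> (2 * m + 1))"
    have "(\<Sum>\<sigma> | \<sigma> permutes {..<2 * k}. of_int (sign \<sigma>) *
        (\<Sum>m<k. ?d w m \<sigma> * (\<Prod>m'\<in>{..<k} - {m}. ?b m' \<sigma>)))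
      = (\<Sum>\<sigma> | \<sigma> permutes {..<2 * k}. of_int (sign \<sigma>) * (\<Sum>i<2 * k. ?P \<sigma> i))"
      by (intro sum.cong refl) (simp only: mem_Collect_eq eq)
    also have "\<dots> = (\<Sum>i<2 * k. \<Sum>\<sigma> | \<sigma> permutes {..<2 * k}. of_int (sign \<sigma>) * ?P \<sigma> i)"
      unfolding sum_distrib_left by (rule sum.swap)
    finally show ?thesis by (simp only: pair_form_def len length_list_update if_True simp_thms)
  qed
  ultimately show ?thesis by (simp add: pair_form_def len)
qed

lemma pair_form_null_head:
  assumes "\<And>m v. m < k \<Longrightarrow> B m z v = 0" "\<And>m v. m < k \<Longrightarrow> B m v z = 0"
  shows "pair_form k B (z # vs) = 0"
proof (cases "Suc (length vs) = 2 * k")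
  case True
  have "(\<Prod>m<k. B m ((z # vs) ! \<sigma> (2 * m)) ((z # vs) ! \<sigma> (2 * m + 1))) = 0"
    if s: "\<sigma> permutes {..<2 * k}" for \<sigma>
  proof -
    have "0 < 2 * k" using True by simp
    \<comment> \<open>Every summand reads the head of the list in some factor, and that factor has
      the null vector \<open>z\<close> in one slot.\<close>
    then obtain j where j: "0 = \<sigma> j" "j < 2 * k"
      using permutes_surj[OF s] permutes_in_image[OF s] by (metis lessThan_iff surjD)
    have "j = 2 * (j div 2) \<or> j = 2 * (j div 2) + 1" "j div 2 < k" using j by auto
    then have "\<sigma> (2 * (j div 2)) = 0 \<or> \<sigma> (2 * (j div 2) + 1) = 0" using j by metis
    then have "B (j div 2) ((z # vs) ! \<sigma> (2 * (j div 2))) ((z # vs) ! \<sigma> (2 * (j div 2) + 1)) = 0"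
      using assms \<open>j div 2 < k\<close> by auto
    then show ?thesis using \<open>j div 2 < k\<close> by auto
  qed
  then have "(\<Sum>\<sigma> | \<sigma> permutes {..<2 * k}. of_int (sign \<sigma>) *
     (\<Prod>m<k. B m ((z # vs) ! \<sigma> (2 * m)) ((z # vs) ! \<sigma> (2 * m + 1)))) = 0"
    by (intro sum.neutral ballI) (simp only: mem_Collect_eq mult_zero_right)
  then show ?thesis unfolding pair_form_def by (simp only: if_cancel)
qed (simp add: pair_form_def)


section \<open>Sign rules: rearranged arguments, repeated deletions, permutations of pairs\<close>

definition delete_nth :: "nat \<Rightarrow> 'a list \<Rightarrow> 'a list" where
  "delete_nth i vs = take i vs @ drop (Suc i) vs"

lemma length_delete_nth: "i < length vs \<Longrightarrow> length (delete_nth i vs) = length vs - 1"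
  by (simp add: delete_nth_def)

lemma nth_delete_nth: "i < length vs \<Longrightarrow> j < length vs - 1 \<Longrightarrow> delete_nth i vs ! j = vs ! (if j < i then j else Suc j)"
  by (auto simp: delete_nth_def nth_append min_def)

text \<open>The simplicial identity: after entry \<open>j\<close> is removed, the later entry
  \<open>i\<close> sits at \<open>i - 1\<close>.\<close>

lemma delete_nth_delete_nth:
  assumes "j < i" "i < length vs"
  shows "delete_nth (i - 1) (delete_nth j vs) = delete_nth j (delete_nth i vs)"
  using assms by (intro nth_equalityI) (auto simp: length_delete_nth nth_delete_nth)

text \<open>Polarisation: expand the vanishing value with \<open>a + b\<close> in both adjacent
  slots.\<close>

lemma alternating_swap:
  assumes "alternating k \<alpha>" "length xs + length ys + 2 = k"
  shows "\<alpha> (xs @ a # b # ys) = - \<alpha> (xs @ b # a # ys)"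
proof -
  let ?i = "length xs" and ?j = "Suc (length xs)"
  have lin: "linear (\<lambda>v. \<alpha> (vs[i := v]))" if "length vs = k" "i < k" for vs i
    using assms(1) that by (auto simp: alternating_def)
  have van: "\<alpha> (xs @ u # u # ys) = 0" for u
  proof -
    have "length (xs @ u # u # ys) = k" "?i < ?j" "?j < k" "(xs @ u # u # ys) ! ?i = (xs @ u # u # ys) ! ?j"
      using assms(2) by (auto simp: nth_append)
    then show ?thesis using assms(1) unfolding alternating_def by blast
  qed
  have 1: "linear (\<lambda>u. \<alpha> (xs @ u # v # ys))" for v
    using lin[of "xs @ v # v # ys" ?i] assms(2) by (simp add: list_update_append)
  have 2: "linear (\<lambda>v. \<alpha> (xs @ u # v # ys))" for u
    using lin[of "xs @ u # u # ys" ?j] assms(2) by (simp add: list_update_append)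
  have "\<alpha> (xs @ (a + b) # (a + b) # ys) = 0" by (rule van)
  then have "\<alpha> (xs @ a # a # ys) + \<alpha> (xs @ b # a # ys) + (\<alpha> (xs @ a # b # ys) + \<alpha> (xs @ b # b # ys)) = 0"
    by (simp only: linear_add[OF 1] linear_add[OF 2])
  then show ?thesis by (simp add: van)
qed

lemma alternating_move_front:
  assumes "alternating k \<alpha>" "length xs + length ys + 1 = k"
  shows "\<alpha> (xs @ w # ys) = (-1) ^ length xs * \<alpha> (w # xs @ ys)"
  using assms(2)
proof (induction xs arbitrary: ys rule: rev_induct)
  case (snoc a xs)
  have "\<alpha> ((xs @ [a]) @ w # ys) = - \<alpha> (xs @ w # a # ys)"
    using alternating_swap[OF assms(1), of xs ys a w] snoc.prems by simp
  also have "\<dots> = - ((-1) ^ length xs * \<alpha> (w # xs @ a # ys))"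
    using snoc.IH[of "a # ys"] snoc.prems by simp
  finally show ?case by simp
qed simp

text \<open>Torsion-freeness makes the exterior derivative the alternation of the covariant derivative:
  the Christoffel terms of the positions \<open>i\<close> and \<open>j\<close> cancel.\<close>

lemma alternating_christoffel_sum:
  assumes alt: "alternating k \<alpha>" and \<Gamma>: "\<And>u v. \<Gamma> u v = \<Gamma> v u" and len: "length vs = Suc k"
  shows "(\<Sum>i<Suc k. (-1) ^ i * (\<Sum>j<k. \<alpha> ((delete_nth i vs)[j := \<Gamma> (vs ! i) (delete_nth i vs ! j)]))) = 0"
proof -
  \<comment> \<open>The Christoffel vector is moved to the front at the cost of (-1)^j, which leaves
    a list with two original entries removed.\<close>
  define t where "t i j = (-1) ^ (i + j) * \<alpha> (\<Gamma> (vs ! i) (delete_nth i vs ! j) # delete_nth j (delete_nth i vs))" for i j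
  have eq: "(-1) ^ i * \<alpha> ((delete_nth i vs)[j := \<Gamma> (vs ! i) (delete_nth i vs ! j)]) = t i j" if "i < Suc k" "j < k" for i j
  proof -
    have l: "length (delete_nth i vs) = k" using that len by (simp add: length_delete_nth)
    then show ?thesis using that
      alternating_move_front[OF alt, of "take j (delete_nth i vs)" "drop (Suc j) (delete_nth i vs)" "\<Gamma> (vs ! i) (delete_nth i vs ! j)"]
      by (simp add: upd_conv_take_nth_drop t_def delete_nth_def[of j] power_add)
  qed
  have flip: "t i j = - t j (i - 1)" if "j < i" "i < Suc k" for i j
  proof -
    have "delete_nth i vs ! j = vs ! j" "delete_nth j vs ! (i - 1) = vs ! i"
      using that len by (auto simp: nth_delete_nth)
    moreover have "(-1::real) ^ (i + j) = - ((-1) ^ (j + (i - 1)))"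
      using that by (cases i) (auto simp: add.commute)
    ultimately show ?thesis
      using delete_nth_delete_nth[of j i vs] that len \<Gamma>[of "vs ! i" "vs ! j"] by (simp add: t_def)
  qed
  \<comment> \<open>As \<open>j\<close> counts positions in the list without entry \<open>i\<close>,
    a removed pair with j < i arises from (i, j) in \<open>?L\<close> and again from (j, i - 1) in
    \<open>?R\<close>, with opposite signs.\<close>
  let ?L = "{(i, j). j < i \<and> i < Suc k}" and ?R = "{(i, j). i \<le> j \<and> j < k}"
  have fin: "finite ?L" "finite ?R"
    by (rule finite_subset[of _ "{..k} \<times> {..k}"]; force)+
  have "(\<Sum>(i, j)\<in>?L. t i j) = (\<Sum>(i, j)\<in>?R. - t i j)"
    by (rule sum.reindex_bij_witness[of _ "\<lambda>(i, j). (Suc j, i)" "\<lambda>(i, j). (j, i - 1)"])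
      (auto simp: flip)
  moreover have "(\<Sum>i<Suc k. \<Sum>j<k. t i j) = (\<Sum>(i, j)\<in>?L \<union> ?R. t i j)"
    unfolding sum.cartesian_product by (rule sum.cong) auto
  moreover have "(\<Sum>(i, j)\<in>?L \<union> ?R. t i j) = (\<Sum>(i, j)\<in>?L. t i j) + (\<Sum>(i, j)\<in>?R. t i j)"
    by (rule sum.union_disjoint) (use fin in auto)
  ultimately have "(\<Sum>i<Suc k. \<Sum>j<k. t i j) = 0"
    by (simp add: sum_negf case_prod_unfold)
  then show ?thesis by (simp add: sum_distrib_left eq cong: sum.cong_simp)
qed

text \<open>Such a permutation maps blocks {2m, 2m + 1} to blocks. Exchanging two blocks is even,
  being two transpositions, so the sign only records the blocks whose inner order is reversed. The
  induction brings the last block home and peels it off.\<close>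

lemma sign_pair_permutation:
  fixes k :: nat
  assumes "\<sigma> permutes {..<2 * k}" "\<And>m. m < k \<Longrightarrow> \<sigma> (2 * m) div 2 = \<sigma> (2 * m + 1) div 2"
  shows "sign \<sigma> * (\<Prod>m<k. if \<sigma> (2 * m) < \<sigma> (2 * m + 1) then 1 else - 1) = (1 :: int)"
  using assms
proof (induction k arbitrary: \<sigma>)
  case 0
  then show ?case by simp
next
  case (Suc k)
  let ?s = "\<lambda>\<sigma> m. if \<sigma> (2 * m) < \<sigma> (2 * m + 1) then 1 else - 1 :: int"
  let ?tr = Transposition.transpose
  define l where "l = \<sigma> (2 * k) div 2"
  have s_in: "\<sigma> a < 2 * Suc k \<longleftrightarrow> a < 2 * Suc k" for a using permutes_in_image[OF Suc.prems(1)] by auto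
  have lk: "l \<le> k" using s_in[of "2 * k"] by (auto simp: l_def)
  \<comment> \<open>\<open>\<rho>\<close> exchanges the blocks \<open>l\<close> and
    \<open>k\<close>; composing with it keeps the sign and all inner orders and makes \<sigma> fix
    the last block as a set.\<close>
  define \<rho> where "\<rho> = ?tr (2 * l) (2 * k) \<circ> ?tr (2 * l + 1) (2 * k + 1)"
  have rho: "\<rho> a = 2 * ?tr l k (a div 2) + a mod 2" for a
    unfolding \<rho>_def Transposition.transpose_def comp_apply by (auto; presburger)
  have \<rho>_perm: "\<rho> permutes {..<2 * Suc k}"
    unfolding \<rho>_def using lk by (intro permutes_compose permutes_swap_id) auto
  have sign_\<rho>: "sign \<rho> = 1"
    unfolding \<rho>_def by (simp add: sign_compose permutation_swap_id sign_swap_id)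
  define \<sigma>1 where "\<sigma>1 = \<rho> \<circ> \<sigma>"
  have p1: "\<sigma>1 permutes {..<2 * Suc k}" unfolding \<sigma>1_def by (rule permutes_compose[OF Suc.prems(1) \<rho>_perm])
  have perm: "permutation \<sigma>" "permutation \<rho>" "permutation \<sigma>1"
    using Suc.prems(1) \<rho>_perm p1 permutation_permutes by blast+
  have sign1: "sign \<sigma>1 = sign \<sigma>" unfolding \<sigma>1_def by (simp add: sign_compose perm sign_\<rho>)
  have div1: "\<sigma>1 (2 * m) div 2 = \<sigma>1 (2 * m + 1) div 2" if "m < Suc k" for m
    using Suc.prems(2)[OF that] by (simp add: \<sigma>1_def rho)
  have s1: "?s \<sigma>1 m = ?s \<sigma> m" if "m < Suc k" for m
  proof -
    have "\<sigma>1 (2 * m) < \<sigma>1 (2 * m + 1) \<longleftrightarrow> \<sigma> (2 * m) mod 2 < \<sigma> (2 * m + 1) mod 2"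
      unfolding \<sigma>1_def comp_apply rho Suc.prems(2)[OF that] by simp
    also have "\<dots> \<longleftrightarrow> \<sigma> (2 * m) < \<sigma> (2 * m + 1)"
      using Suc.prems(2)[OF that] div_mult_mod_eq[of "\<sigma> (2 * m)" 2] div_mult_mod_eq[of "\<sigma> (2 * m + 1)" 2]
      by linarith
    finally show ?thesis by simp
  qed
  have k0: "\<sigma>1 (2 * k) div 2 = k" by (simp add: \<sigma>1_def rho l_def[symmetric])
  have inj1: "\<sigma>1 a = \<sigma>1 b \<longleftrightarrow> a = b" for a b using permutes_inj[OF p1] by (auto simp: inj_def)
  have cases: "\<sigma>1 (2 * k) = 2 * k \<and> \<sigma>1 (2 * k + 1) = 2 * k + 1 \<or>
      \<sigma>1 (2 * k) = 2 * k + 1 \<and> \<sigma>1 (2 * k + 1) = 2 * k"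
    using k0 div1[of k] inj1[of "2 * k" "2 * k + 1"] by simp linarith
  have restrict: "\<tau> permutes {..<2 * k}"
    if "\<tau> permutes {..<2 * Suc k}" "\<tau> (2 * k) = 2 * k" "\<tau> (2 * k + 1) = 2 * k + 1" for \<tau>
  proof (rule permutes_superset[OF that(1)])
    fix x assume "x \<in> {..<2 * Suc k} - {..<2 * k}"
    then have "x = 2 * k \<or> x = 2 * k + 1" by auto
    then show "\<tau> x = x" using that by auto
  qed
  have "sign \<sigma>1 * (\<Prod>m<Suc k. ?s \<sigma>1 m) = 1"
    using cases
  proof
    assume c: "\<sigma>1 (2 * k) = 2 * k \<and> \<sigma>1 (2 * k + 1) = 2 * k + 1"
    have "sign \<sigma>1 * (\<Prod>m<k. ?s \<sigma>1 m) = 1"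
      by (rule Suc.IH[OF restrict[OF p1]]) (use c div1 in auto)
    then show ?thesis using c by simp
  next
    assume c: "\<sigma>1 (2 * k) = 2 * k + 1 \<and> \<sigma>1 (2 * k + 1) = 2 * k"
    \<comment> \<open>The last block is reversed; undoing this costs one transposition, matched by
      the factor -1 of that block.\<close>
    define \<sigma>2 where "\<sigma>2 = ?tr (2 * k) (2 * k + 1) \<circ> \<sigma>1"
    have p2: "\<sigma>2 permutes {..<2 * Suc k}"
      unfolding \<sigma>2_def using p1 by (intro permutes_compose permutes_swap_id) auto
    have c2: "\<sigma>2 (2 * k) = 2 * k" "\<sigma>2 (2 * k + 1) = 2 * k + 1" using c by (auto simp: \<sigma>2_def)
    have same: "\<sigma>2 a = \<sigma>1 a" if "a < 2 * k" for a
    proof -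
      have "\<sigma>1 a \<noteq> 2 * k" "\<sigma>1 a \<noteq> 2 * k + 1"
        using inj1[of a "2 * k"] inj1[of a "2 * k + 1"] c that by auto
      then show ?thesis by (simp add: \<sigma>2_def Transposition.transpose_def)
    qed
    have "sign \<sigma>2 * (\<Prod>m<k. ?s \<sigma>2 m) = 1"
      by (rule Suc.IH[OF restrict[OF p2 c2]]) (use same div1 in auto)
    moreover have "(\<Prod>m<k. ?s \<sigma>2 m) = (\<Prod>m<k. ?s \<sigma>1 m)" by (intro prod.cong refl) (use same in auto)
    moreover have "sign \<sigma>2 = - sign \<sigma>1"
      unfolding \<sigma>2_def by (simp add: sign_compose permutation_swap_id perm sign_swap_id)
    ultimately show ?thesis using c by simp
  qed
  moreover have "(\<Prod>m<Suc k. ?s \<sigma>1 m) = (\<Prod>m<Suc k. ?s \<sigma> m)" by (intro prod.cong refl s1) auto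
  ultimately show ?case using sign1 by simp
qed

section \<open>Products of 2-forms on arguments in orthogonal blocks of two\<close>

context
  fixes k :: nat and B :: "nat \<Rightarrow> 'e \<Rightarrow> 'e \<Rightarrow> real" and vs :: "'e list"
  assumes len: "length vs = 2 * k"
    and skew: "\<And>m u v. m < k \<Longrightarrow> B m u v = - B m v u"
    and cross: "\<And>m i j. m < k \<Longrightarrow> i < 2 * k \<Longrightarrow> j < 2 * k \<Longrightarrow> i div 2 \<noteq> j div 2 \<Longrightarrow> B m (vs ! i) (vs ! j) = 0"
begin

lemma pair_form_factor:
  assumes s: "\<sigma> permutes {..<2 * k}" and m: "m < k" and eq: "\<sigma> (2 * m) div 2 = \<sigma> (2 * m + 1) div 2"
  shows "B m (vs ! \<sigma> (2 * m)) (vs ! \<sigma> (2 * m + 1)) =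
    (if \<sigma> (2 * m) < \<sigma> (2 * m + 1) then 1 else - 1) *
      B m (vs ! (2 * (\<sigma> (2 * m) div 2))) (vs ! (2 * (\<sigma> (2 * m) div 2) + 1))"
proof -
  define l where "l = \<sigma> (2 * m) div 2"
  have "\<sigma> (2 * m) = 2 * l \<and> \<sigma> (2 * m + 1) = 2 * l + 1 \<or> \<sigma> (2 * m) = 2 * l + 1 \<and> \<sigma> (2 * m + 1) = 2 * l"
    using permuted_pair_index(3)[OF s m] eq unfolding l_def by linarith
  then show ?thesis
    unfolding l_def[symmetric] using skew[OF m, of "vs ! (2 * l + 1)" "vs ! (2 * l)"] by auto
qed

text \<open>Some summand is nonzero, and by \<open>cross\<close> its permutation cannot split a
  block. Its action on the blocks is the matching \<tau> of factors with argument pairs.\<close>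

lemma pair_form_nonzero_matching:
  assumes "pair_form k B vs \<noteq> 0"
  obtains \<tau> where "\<tau> ` {..<k} \<subseteq> {..<k}" "inj_on \<tau> {..<k}"
    "\<And>m. m < k \<Longrightarrow> B m (vs ! (2 * \<tau> m)) (vs ! (2 * \<tau> m + 1)) \<noteq> 0"
proof -
  obtain \<sigma> where s: "\<sigma> permutes {..<2 * k}"
    and nz: "of_int (sign \<sigma>) * (\<Prod>m<k. B m (vs ! \<sigma> (2 * m)) (vs ! \<sigma> (2 * m + 1))) \<noteq> 0"
    using assms unfolding pair_form_def by (metis (mono_tags, lifting) mem_Collect_eq sum.neutral)
  have f: "B m (vs ! \<sigma> (2 * m)) (vs ! \<sigma> (2 * m + 1)) \<noteq> 0" if "m < k" for m
    using nz that by (auto simp del: One_nat_def add_Suc_right)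
  have d: "\<sigma> (2 * m) div 2 = \<sigma> (2 * m + 1) div 2" if "m < k" for m
    using f[OF that] cross[OF that permuted_pair_index(1,2)[OF s that]] by blast
  show ?thesis
  proof (rule that[of "\<lambda>m. \<sigma> (2 * m) div 2"])
    show "(\<lambda>m. \<sigma> (2 * m) div 2) ` {..<k} \<subseteq> {..<k}"
      using permuted_pair_index(1)[OF s] by fastforce
    show "inj_on (\<lambda>m. \<sigma> (2 * m) div 2) {..<k}"
    proof (rule inj_onI; rule ccontr)
      fix m m' assume m: "m \<in> {..<k}" "m' \<in> {..<k}" "\<sigma> (2 * m) div 2 = \<sigma> (2 * m') div 2" "m \<noteq> m'"
      have i: "\<sigma> a = \<sigma> b \<longleftrightarrow> a = b" for a b using permutes_inj[OF s] by (auto simp: inj_def)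
      \<comment> \<open>Otherwise three distinct values of \<sigma> would lie in a block of
        two.\<close>
      have "\<sigma> (2 * m) \<noteq> \<sigma> (2 * m + 1)" "\<sigma> (2 * m) \<noteq> \<sigma> (2 * m')" "\<sigma> (2 * m + 1) \<noteq> \<sigma> (2 * m')"
        using m(4) unfolding i by presburger+
      then show False using d[of m] m by auto
    qed
    show "B m (vs ! (2 * (\<sigma> (2 * m) div 2))) (vs ! (2 * (\<sigma> (2 * m) div 2) + 1)) \<noteq> 0" if "m < k" for m
      using f[OF that] pair_form_factor[OF s that d[OF that]] by auto
  qed
qed

text \<open>No cancellation can occur: permutations that split a block contribute zero, and for the
  others the sign is absorbed by reordering inside the blocks, leaving a nonnegative product. The
  identity contributes a positive one.\<close>

lemma pair_form_pos:
  assumes nonneg: "\<And>m l. m < k \<Longrightarrow> l < k \<Longrightarrow> B m (vs ! (2 * l)) (vs ! (2 * l + 1)) \<ge> 0"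
    and pos: "\<And>m. m < k \<Longrightarrow> B m (vs ! (2 * m)) (vs ! (2 * m + 1)) > 0"
  shows "pair_form k B vs > 0"
proof -
  define f where "f = (\<lambda>\<sigma>. of_int (sign \<sigma>) * (\<Prod>m<k. B m (vs ! \<sigma> (2 * m)) (vs ! \<sigma> (2 * m + 1))))"
  have "f \<sigma> \<ge> 0" if s: "\<sigma> permutes {..<2 * k}" for \<sigma>
  proof (cases "\<forall>m<k. \<sigma> (2 * m) div 2 = \<sigma> (2 * m + 1) div 2")
    case False
    then obtain m where m: "m < k" "\<sigma> (2 * m) div 2 \<noteq> \<sigma> (2 * m + 1) div 2" by blast
    then have "B m (vs ! \<sigma> (2 * m)) (vs ! \<sigma> (2 * m + 1)) = 0"
      using cross[OF m(1) permuted_pair_index(1,2)[OF s m(1)]] by blast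
    then have "(\<Prod>m<k. B m (vs ! \<sigma> (2 * m)) (vs ! \<sigma> (2 * m + 1))) = 0"
      using m(1) by (intro prod_zero) auto
    then show ?thesis by (simp only: f_def mult_zero_right order_refl)
  next
    case True
    let ?s = "\<lambda>m. if \<sigma> (2 * m) < \<sigma> (2 * m + 1) then 1 else - 1 :: int"
    let ?D = "\<lambda>m. B m (vs ! (2 * (\<sigma> (2 * m) div 2))) (vs ! (2 * (\<sigma> (2 * m) div 2) + 1))"
    have "(\<Prod>m<k. B m (vs ! \<sigma> (2 * m)) (vs ! \<sigma> (2 * m + 1))) = (\<Prod>m<k. of_int (?s m) * ?D m)"
      using True by (intro prod.cong refl) (subst pair_form_factor[OF s]; simp)
    then have "f \<sigma> = of_int (sign \<sigma> * (\<Prod>m<k. ?s m)) * (\<Prod>m<k. ?D m)"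
      unfolding f_def by (simp only: prod.distrib of_int_mult of_int_prod mult.assoc)
    also have "\<dots> = (\<Prod>m<k. ?D m)" using sign_pair_permutation[OF s] True by simp
    also have "\<dots> \<ge> 0"
    proof (rule prod_nonneg, rule nonneg)
      fix m assume "m \<in> {..<k}"
      then show "m < k" "\<sigma> (2 * m) div 2 < k" using permuted_pair_index(1)[OF s, of m] by auto
    qed
    finally show ?thesis .
  qed
  moreover have "f id > 0" unfolding f_def using pos by (auto intro!: prod_pos)
  ultimately have "sum f {\<sigma>. \<sigma> permutes {..<2 * k}} > 0"
    by (intro sum_pos2[of _ id]) (auto simp: permutes_id finite_permutations)
  then show ?thesis by (simp only: pair_form_def f_def len if_True simp_thms)
qed

end

section \<open>Parallel forms and dimension bounds\<close>

lemma ext_deriv_zero_form: "(\<And>p vs. \<omega> p vs = 0) \<Longrightarrow> ext_deriv A \<omega> p vs = 0"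
  by (simp add: ext_deriv_def form_rep_def Let_def frechet_derivative_const)

lemma codiff_zero_form: "(\<And>p vs. \<omega> p vs = 0) \<Longrightarrow> codiff A g \<omega> p vs = 0"
  by (simp add: codiff_def nabla_def form_rep_def Let_def frechet_derivative_const)

text \<open>The hypothesis says that \<open>nabla\<close> vanishes on \<omega>. The codifferential
  is a trace of \<open>nabla\<close>, and the exterior derivative is its alternation because the
  Christoffel symbol is symmetric.\<close>

lemma parallel_form_harmonic:
  fixes A :: "('a::topological_space, 'e::euclidean_space) chart set"
  assumes atlas: "smooth_atlas A" and metric: "riemannian_metric A g" and form: "\<omega> \<in> forms A k"
    and parallel: "\<And>p vs. ((\<lambda>x. form_rep A (chart_at A p) \<omega> x vs) has_derivative
      (\<lambda>w. \<Sum>i<length vs. \<omega> p (vs[i := christoffel A g p w (vs ! i)]))) (at (coord_at A p))"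
  shows "\<omega> \<in> harmonic_forms A g k"
proof -
  have alt: "alternating k (\<omega> p)" for p using form by (simp add: forms_def)
  have deriv: "frechet_derivative (\<lambda>x. form_rep A (chart_at A p) \<omega> x vs) (at (coord_at A p)) w
     = (\<Sum>i<length vs. \<omega> p (vs[i := christoffel A g p w (vs ! i)]))" for p vs w
    using fun_cong[OF frechet_derivative_at[OF parallel]] by (rule sym)
  have "nabla A g p u \<omega> vs = 0" for p u vs by (simp add: nabla_def deriv)
  then have coclosed: "codiff A g \<omega> p vs = 0" for p vs by (simp add: codiff_def)
  have closed: "ext_deriv A \<omega> p vs = 0" for p vs
  proof (cases "length vs = Suc k")
    case True
    have "ext_deriv A \<omega> p vs = (\<Sum>i<Suc k. (-1) ^ i *
       (\<Sum>j<k. \<omega> p ((delete_nth i vs)[j := christoffel A g p (vs ! i) (delete_nth i vs ! j)])))"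
      unfolding ext_deriv_def delete_nth_def[symmetric] deriv True
      by (intro sum.cong refl) (simp add: length_delete_nth True)
    also have "\<dots> = 0"
      by (rule alternating_christoffel_sum[OF alt christoffel_sym[OF atlas metric] True])
    finally show ?thesis .
  next
    case False
    \<comment> \<open>Forms vanish on lists of the wrong length. The empty list is kept apart
      because of truncated subtraction when \<open>k\<close> is 0; there the sum in
      \<open>ext_deriv\<close> is empty.\<close>
    then have "\<omega> q ws = 0" if "length ws = length vs - 1" "vs \<noteq> []" for q ws
      using alt[of q] that by (cases vs) (auto simp: alternating_def)
    then show ?thesis
      unfolding ext_deriv_def delete_nth_def[symmetric] deriv
      by (cases "vs = []") (auto simp: length_delete_nth intro!: sum.neutral)
  qed
  show ?thesis
    using form by (simp add: harmonic_forms_def laplacian_def ext_deriv_zero_form[OF coclosed]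
      codiff_zero_form[OF closed])
qed

text \<open>Evaluation at \<open>p\<close> on the lists \<open>v j\<close> turns the family
  \<open>w\<close> into a diagonal matrix with nonzero entries, which gives independence. If
  \<open>V\<close> has no finite spanning set, \<open>form_dim\<close> is infinite by
  definition.\<close>

lemma form_dim_lower_bound:
  fixes V :: "('a, 'e) form set" and w :: "'i \<Rightarrow> ('a, 'e) form"
  assumes fin: "finite I" and wV: "\<And>i. i \<in> I \<Longrightarrow> w i \<in> V"
    and diag: "\<And>i. i \<in> I \<Longrightarrow> w i p (v i) \<noteq> 0"
    and off: "\<And>i j. i \<in> I \<Longrightarrow> j \<in> I \<Longrightarrow> i \<noteq> j \<Longrightarrow> w i p (v j) = 0"
  shows "enat (card I) \<le> form_dim V"
proof (cases "\<exists>B. finite B \<and> V \<subseteq> form_space.span B")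
  case True
  then obtain B where B: "finite B" "V \<subseteq> form_space.span B" by blast
  have inj: "inj_on w I"
    using diag off by (intro inj_onI) metis
  have "form_space.independent (w ` I)"
  proof
    assume "form_space.dependent (w ` I)"
    then obtain u where u: "\<exists>x\<in>w ` I. u x \<noteq> 0" "(\<Sum>x\<in>w ` I. (\<lambda>q vs. u x * x q vs)) = 0"
      using form_space.dependent_finite[of "w ` I"] fin by auto
    have apply_sum: "(\<Sum>x\<in>X. (\<lambda>q vs. u x * x q vs)) q vs = (\<Sum>x\<in>X. u x * x q vs)" if "finite X" for X q vs
      using that by (induction X rule: finite_induct) auto
    obtain j where j: "j \<in> I" "u (w j) \<noteq> 0" using u(1) by auto
    have "0 = (\<Sum>x\<in>w ` I. u x * x p (v j))"
      using apply_sum[of "w ` I" p "v j"] u(2) fin by simp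
    also have "\<dots> = (\<Sum>i\<in>I. u (w i) * w i p (v j))" by (simp add: sum.reindex[OF inj])
    also have "\<dots> = u (w j) * w j p (v j)"
      using j off fin by (subst sum.remove[of _ j]) (auto intro!: sum.neutral)
    finally show False using j diag by simp
  qed
  moreover obtain C where C: "C \<subseteq> V" "form_space.independent C" "V \<subseteq> form_space.span C"
    "card C = form_space.dim V"
    using form_space.basis_exists[of V] by auto
  moreover have "finite C"
    using form_space.independent_span_bound[OF B(1) C(2)] C(1) B(2) by auto
  ultimately have "card (w ` I) \<le> card C"
    using form_space.independent_span_bound[of C "w ` I"] wV by blast
  then show ?thesis using True C(4) by (auto simp: form_dim_def card_image[OF inj])
next
  case False
  then have "form_dim V = \<infinity>" unfolding form_dim_def by (rule if_not_P)
  then show ?thesis by simp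
qed

section \<open>Exponent pairs: their number and their recovery from a matching\<close>

lemma card_pairs_sum_le: "card {(i, j). i + j \<le> k} = (k + 2) choose 2"
proof -
  have "{(i, j). i + j \<le> k} = Sigma {0..k} (\<lambda>i. {..k - i})" by auto
  then have "card {(i, j). i + j \<le> k} = (\<Sum>i\<in>{0..k}. Suc (k - i))" by simp
  also have "\<dots> = (\<Sum>i\<in>{0..k}. Suc i)"
    using sum.atLeastAtMost_rev[of "\<lambda>i. Suc i" 0 k] by simp
  also have "\<dots> = (k + 2) choose 2" by (induction k) (auto simp: numeral_2_eq_2)
  finally show ?thesis .
qed

text \<open>The factors of the monomial with exponent pair \<open>s\<close>, in weakly increasing
  order; the third exponent is whatever completes the degree.\<close>

definition block_index :: "nat \<times> nat \<Rightarrow> nat \<Rightarrow> nat" where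
  "block_index s m = (if m < fst s then 1 else if m < fst s + snd s then 2 else 3)"

lemma block_index_mem: "block_index s m \<in> {1..3}"
  by (simp add: block_index_def)

text \<open>A bijection respecting the indices preserves the number of ones and of twos, and these
  numbers are the two exponents.\<close>

lemma block_index_eqI:
  assumes s: "fst s + snd s \<le> k" and t: "fst t + snd t \<le> k"
    and \<tau>: "\<tau> ` {..<k} \<subseteq> {..<k}" "inj_on \<tau> {..<k}"
    and eq: "\<And>m. m < k \<Longrightarrow> block_index s m = block_index t (\<tau> m)"
  shows "s = t"
proof -
  have bij: "\<tau> ` {..<k} = {..<k}" using \<tau> by (simp add: endo_inj_surj)
  have "card {m\<in>{..<k}. block_index s m = a} = card {m\<in>{..<k}. block_index t m = a}" for a
  proof (rule bij_betw_same_card[of \<tau>])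
    show "bij_betw \<tau> {m\<in>{..<k}. block_index s m = a} {m\<in>{..<k}. block_index t m = a}"
      unfolding bij_betw_def
    proof
      show "inj_on \<tau> {m\<in>{..<k}. block_index s m = a}" using \<tau>(2) by (rule inj_on_subset) auto
      show "\<tau> ` {m\<in>{..<k}. block_index s m = a} = {m\<in>{..<k}. block_index t m = a}"
        using bij eq by (auto simp: image_iff set_eq_iff) (metis lessThan_iff)+
    qed
  qed
  note same = this
  have sets: "{m\<in>{..<k}. block_index r m = 1} = {..<fst r}"
    "{m\<in>{..<k}. block_index r m = 2} = {fst r..<fst r + snd r}" if "fst r + snd r \<le> k" for r
    using that by (auto simp: block_index_def split: if_splits)
  have "fst s = fst t" "snd s = snd t"
    using same[of 1] same[of 2] unfolding sets[OF s] sets[OF t] by simp_all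
  then show ?thesis by (simp add: prod_eq_iff)
qed

section \<open>Parallel forms of a 3-cosymplectic structure\<close>

definition horizontal_form ::
  "(nat \<Rightarrow> ('a, 'e) endo) \<Rightarrow> (nat \<Rightarrow> ('a, 'e) form) \<Rightarrow> ('a, 'e) bilin \<Rightarrow> nat \<Rightarrow> ('a, 'e) bilin" where
  "horizontal_form \<phi> \<eta> g a p u v = fundamental_form (\<phi> a) g p [u, v]
     + (\<Sum>b\<in>{1..3}. \<Sum>c\<in>{1..3}. levi_civita a b c * (\<eta> b p [u] * \<eta> c p [v]))"

lemma index_set: "{1..3::nat} = {1, 2, 3}"
  by auto

lemma sum_index: "(\<Sum>a\<in>{1..3::nat}. f a) = f 1 + f 2 + f 3"
  unfolding index_set by (simp add: add.assoc)

context
  fixes A :: "('a::topological_space, 'e::euclidean_space) chart set" and n :: nat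
    and \<phi> :: "nat \<Rightarrow> ('a, 'e) endo" and \<xi> :: "nat \<Rightarrow> ('a, 'e) vfield"
    and \<eta> :: "nat \<Rightarrow> ('a, 'e) form" and g :: "('a, 'e) bilin"
  assumes atlas: "smooth_atlas A" and three: "three_cosymplectic A n \<phi> \<xi> \<eta> g"
begin

lemma dim_model: "DIM('e) = 4 * n + 3"
  using three by (simp add: three_cosymplectic_def)

lemma cosymplectic_index: "a \<in> {1..3} \<Longrightarrow> cosymplectic A (\<phi> a) (\<xi> a) (\<eta> a) g"
  using three by (simp add: three_cosymplectic_def)

lemma phi_phi:
  "a \<in> {1..3} \<Longrightarrow> b \<in> {1..3} \<Longrightarrow> \<phi> a p (\<phi> b p u) = \<eta> b p [u] *\<^sub>R \<xi> a p
     + ((\<Sum>c\<in>{1..3}. levi_civita a b c *\<^sub>R \<phi> c p u) - (if a = b then u else 0))"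
proof -
  assume "a \<in> {1..3}" "b \<in> {1..3}"
  then have "\<phi> a p (\<phi> b p u) - \<eta> b p [u] *\<^sub>R \<xi> a p
     = (\<Sum>c\<in>{1..3}. levi_civita a b c *\<^sub>R \<phi> c p u) - (if a = b then u else 0)"
    using three unfolding three_cosymplectic_def by blast
  then show ?thesis by (metis add.commute diff_eq_eq)
qed

lemma phi_xi: "a \<in> {1..3} \<Longrightarrow> b \<in> {1..3} \<Longrightarrow> \<phi> a p (\<xi> b p) = (\<Sum>c\<in>{1..3}. levi_civita a b c *\<^sub>R \<xi> c p)"
  using three unfolding three_cosymplectic_def by blast

lemma eta_phi:
  "a \<in> {1..3} \<Longrightarrow> b \<in> {1..3} \<Longrightarrow> \<eta> a p [\<phi> b p u] = (\<Sum>c\<in>{1..3}. levi_civita a b c * \<eta> c p [u])"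
  using three unfolding three_cosymplectic_def by blast

lemma levi_civita_diag [simp]: "levi_civita a a c = 0" "levi_civita a c a = 0" "levi_civita c a a = 0"
  by (auto simp: levi_civita_def)

lemma phi_xi_same: "a \<in> {1..3} \<Longrightarrow> \<phi> a p (\<xi> a p) = 0"
  by (simp add: phi_xi)

lemma eta_phi_same: "a \<in> {1..3} \<Longrightarrow> \<eta> a p [\<phi> a p u] = 0"
  by (simp add: eta_phi)

lemma three_metric: "riemannian_metric A g"
  using cosymplectic_metric[OF atlas cosymplectic_index[of 1] phi_xi_same eta_phi_same] by simp

lemma almost_contact_index:
  "a \<in> {1..3} \<Longrightarrow> almost_contact_vector_space (g p) (\<phi> a p) (\<lambda>u. \<eta> a p [u]) (\<xi> a p)"
  using almost_contact_at[OF atlas cosymplectic_index phi_xi_same eta_phi_same] .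

lemmas linear_eta = almost_contact_vector_space.linh[OF almost_contact_index]
lemmas linear_phi = almost_contact_vector_space.linF[OF almost_contact_index]
lemmas metric_xi = almost_contact_vector_space.G_xi[OF almost_contact_index]
lemmas phi_skew = almost_contact_vector_space.F_skew[OF almost_contact_index]
lemmas Phi_skew_index = almost_contact_vector_space.Phi_skew[OF almost_contact_index]
lemmas g_linear = metric_linear[OF atlas three_metric]

text \<open>For distinct indices let \<open>c\<close> be the third one: \<open>\<xi> b\<close> is,
  up to sign, the image of \<open>\<xi> c\<close> under \<open>\<phi> a\<close>, and
  \<open>\<eta> a\<close> vanishes on images of \<open>\<phi> a\<close>.\<close>

lemma eta_xi:
  assumes "a \<in> {1..3}" "b \<in> {1..3}" shows "\<eta> a p [\<xi> b p] = (if a = b then 1 else 0)"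
proof (cases "a = b")
  case True
  then show ?thesis using almost_contact_vector_space.h\<xi>[OF almost_contact_index[OF assms(1)]] by simp
next
  case False
  have "\<exists>c\<in>{1..3}. levi_civita a c b \<noteq> 0 \<and> (\<forall>d\<in>{1..3}. d \<noteq> b \<longrightarrow> levi_civita a c d = 0)"
    using assms False unfolding index_set by (auto simp: levi_civita_def)
  then obtain c where c: "c \<in> {1..3}" "\<And>d. d \<in> {1..3} \<Longrightarrow> d \<noteq> b \<Longrightarrow> levi_civita a c d = 0"
    "levi_civita a c b \<noteq> 0" by blast
  have "\<phi> a p (\<xi> c p) = levi_civita a c b *\<^sub>R \<xi> b p"
    unfolding phi_xi[OF assms(1) c(1)] using assms(2) c(2)
    by (subst sum.remove[of _ b]) (auto intro!: sum.neutral)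
  then have "levi_civita a c b * \<eta> a p [\<xi> b p] = \<eta> a p [\<phi> a p (\<xi> c p)]"
    by (simp only: linear_scale[OF linear_eta[OF assms(1)]] real_scaleR_def)
  then show ?thesis using c(3) False by (simp add: eta_phi_same[OF assms(1)])
qed

lemma bilinear_horizontal_form:
  assumes a: "a \<in> {1..3}" shows "bilinear (horizontal_form \<phi> \<eta> g a p)"
proof -
  have "linear (\<lambda>u. g p u w)" "linear (\<lambda>u. g p w (\<phi> a p u))" for w
    by (auto intro!: linearI simp: g_linear linear_add[OF linear_phi[OF a]] linear_scale[OF linear_phi[OF a]])
  then show ?thesis
    unfolding bilinear_def horizontal_form_def
    by (auto simp: fundamental_form_def intro!: linear_compose_add linear_compose_sum linear_mult_left
        linear_mult_right linear_eta)
qed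

lemma horizontal_form_skew:
  assumes a: "a \<in> {1..3}" shows "horizontal_form \<phi> \<eta> g a p u v = - horizontal_form \<phi> \<eta> g a p v u"
  using a Phi_skew_index[OF a, of p u v]
  unfolding horizontal_form_def fundamental_form_def sum_index index_set
  by (auto simp: levi_civita_def)

text \<open>The reason for the correction term: on \<open>\<xi> b\<close> the fundamental form gives
  \<open>\<eta> b\<close> after \<open>\<phi> a\<close>, the sum over c of
  \<open>levi_civita b a c\<close> times \<open>\<eta> c\<close>. The correction gives the same sum
  with \<open>levi_civita a b c\<close>, and antisymmetry cancels the two.\<close>

lemma horizontal_form_xi:
  assumes a: "a \<in> {1..3}" and b: "b \<in> {1..3}" shows "horizontal_form \<phi> \<eta> g a p (\<xi> b p) v = 0"
proof -
  have "g p (\<xi> b p) (\<phi> a p v) = (\<Sum>c\<in>{1..3}. levi_civita b a c * \<eta> c p [v])"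
    by (simp only: metric_xi[OF b] eta_phi[OF b a])
  moreover have "\<eta> c p [\<xi> b p] = (if c = b then 1 else 0)" if "c \<in> {1..3}" for c
    using eta_xi[OF that b] .
  note this[of 1] this[of 2] this[of 3]
  ultimately show ?thesis
    using a b unfolding horizontal_form_def fundamental_form_def sum_index index_set
    by (auto simp: levi_civita_def)
qed

lemma horizontal_form_rep:
  "bilin_rep A c (horizontal_form \<phi> \<eta> g a) x u v = form_rep A c (fundamental_form (\<phi> a) g) x [u, v]
     + (\<Sum>b\<in>{1..3}. \<Sum>d\<in>{1..3}. levi_civita a b d * (form_rep A c (\<eta> b) x [u] * form_rep A c (\<eta> d) x [v]))"
  by (simp add: bilin_rep_def form_rep_def horizontal_form_def Let_def)

lemma smooth_horizontal_form_rep: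
  assumes a: "a \<in> {1..3}" and c: "c \<in> A"
  shows "smooth_on (\<lambda>x. bilin_rep A c (horizontal_form \<phi> \<eta> g a) x u v) (chart_image c)"
  unfolding horizontal_form_rep
  by (intro smooth_on_add smooth_on_sum smooth_on_mult smooth_on_const open_chart_image[OF atlas c]
      smooth_form_rep[OF atlas cosymplectic_index phi_xi_same eta_phi_same c] a
      smooth_fundamental_form_rep[OF atlas cosymplectic_index phi_xi_same eta_phi_same c])

lemma has_derivative_horizontal_form_rep:
  assumes a: "a \<in> {1..3}"
  shows "((\<lambda>x. bilin_rep A (chart_at A p) (horizontal_form \<phi> \<eta> g a) x u v) has_derivative
    (\<lambda>w. horizontal_form \<phi> \<eta> g a p (christoffel A g p w u) v
       + horizontal_form \<phi> \<eta> g a p u (christoffel A g p w v))) (at (coord_at A p))"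
proof -
  let ?\<Gamma> = "christoffel A g p"
  have at: "form_rep A (chart_at A p) \<omega> (coord_at A p) [v] = \<omega> p [v]" for \<omega> v
    by (simp add: form_rep_def chart_inv_coord_at[OF atlas] to_tangent_self[OF atlas])
  have "((\<lambda>x. bilin_rep A (chart_at A p) (horizontal_form \<phi> \<eta> g a) x u v) has_derivative
    (\<lambda>w. (g p (?\<Gamma> w u) (\<phi> a p v) + g p u (\<phi> a p (?\<Gamma> w v))) +
      (\<Sum>b\<in>{1..3}. \<Sum>d\<in>{1..3}. levi_civita a b d *
        (form_rep A (chart_at A p) (\<eta> b) (coord_at A p) [u] * \<eta> d p [?\<Gamma> w v]
          + \<eta> b p [?\<Gamma> w u] * form_rep A (chart_at A p) (\<eta> d) (coord_at A p) [v])))) (at (coord_at A p))"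
    unfolding horizontal_form_rep
    by (intro has_derivative_add has_derivative_sum has_derivative_mult_right has_derivative_mult a
      has_derivative_contact_form_rep[OF atlas cosymplectic_index phi_xi_same eta_phi_same]
      has_derivative_fundamental_form_rep[OF atlas cosymplectic_index phi_xi_same eta_phi_same])
  then show ?thesis
    unfolding at horizontal_form_def
    by (simp add: fundamental_form_def sum.distrib algebra_simps)
qed

definition parallel_power where
  "parallel_power k s = (\<lambda>p. pair_form k (\<lambda>m. horizontal_form \<phi> \<eta> g (block_index s m) p))"

lemma parallel_power_harmonic_000: "parallel_power k s \<in> harmonic_forms_000 A \<xi> \<eta> g (2 * k)"
proof -
  have rep: "(\<lambda>x. form_rep A c (parallel_power k s) x vs)
     = (\<lambda>x. pair_form k (\<lambda>m. bilin_rep A c (horizontal_form \<phi> \<eta> g (block_index s m)) x) vs)" for c vs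
    unfolding parallel_power_def by (rule ext) (rule pair_form_rep)
  have rep_at: "bilin_rep A (chart_at A p) h (coord_at A p) = h p" for h p
    by (simp add: fun_eq_iff bilin_rep_def chart_inv_coord_at[OF atlas] to_tangent_self[OF atlas])
  have form: "parallel_power k s \<in> forms A (2 * k)"
    unfolding forms_def
  proof (intro CollectI conjI allI ballI)
    show "alternating (2 * k) (parallel_power k s p)" for p
      unfolding parallel_power_def
      by (rule alternating_pair_form[OF bilinear_horizontal_form[OF block_index_mem]])
    show "smooth_on (\<lambda>x. form_rep A c (parallel_power k s) x vs) (chart_image c)" if "c \<in> A" for c vs
      unfolding rep
      by (rule smooth_on_pair_form[OF open_chart_image[OF atlas that]
            smooth_horizontal_form_rep[OF block_index_mem that]])
  qed
  have "parallel_power k s \<in> harmonic_forms A g (2 * k)"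
  proof (rule parallel_form_harmonic[OF atlas three_metric form])
    fix p vs
    show "((\<lambda>x. form_rep A (chart_at A p) (parallel_power k s) x vs) has_derivative
      (\<lambda>w. \<Sum>i<length vs. parallel_power k s p (vs[i := christoffel A g p w (vs ! i)]))) (at (coord_at A p))"
      unfolding rep
      using has_derivative_pair_form[of k "\<lambda>m. bilin_rep A (chart_at A p) (horizontal_form \<phi> \<eta> g (block_index s m))"
          "coord_at A p" "christoffel A g p" vs]
        has_derivative_horizontal_form_rep[OF block_index_mem]
      by (simp add: rep_at parallel_power_def)
  qed
  moreover have "contract (\<xi> a) (parallel_power k s) p vs = 0" if "a \<in> {1..3}" for a p vs
    unfolding contract_def parallel_power_def
  proof (rule pair_form_null_head)
    fix m u
    show "horizontal_form \<phi> \<eta> g (block_index s m) p (\<xi> a p) u = 0"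
      by (rule horizontal_form_xi[OF block_index_mem that])
    then show "horizontal_form \<phi> \<eta> g (block_index s m) p u (\<xi> a p) = 0"
      using horizontal_form_skew[OF block_index_mem, of s m p u "\<xi> a p"] by simp
  qed
  ultimately show ?thesis
    by (simp add: harmonic_forms_000_def e_op_def wedge_def)
qed

section \<open>Orthogonal quaternionic lines in a horizontal space\<close>

lemma horizontal_form_horizontal:
  assumes "\<And>b. b \<in> {1..3} \<Longrightarrow> \<eta> b p [u] = 0"
  shows "horizontal_form \<phi> \<eta> g a p u v = g p u (\<phi> a p v)"
  using assms by (simp add: horizontal_form_def fundamental_form_def)

text \<open>Horizontal vectors orthogonal to the quaternionic line of \<open>e\<close>. The maps
  \<open>\<phi> a\<close> stand on \<open>w\<close> instead of on \<open>e\<close>, which is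
  equivalent by skewness.\<close>

definition quaternionic_perp :: "'a \<Rightarrow> 'e \<Rightarrow> 'e set" where
  "quaternionic_perp p e = {w. (\<forall>b\<in>{1..3}. \<eta> b p [w] = 0) \<and> g p e w = 0 \<and> (\<forall>a\<in>{1..3}. g p e (\<phi> a p w) = 0)}"

lemma eta_phi_zero:
  assumes "\<And>c. c \<in> {1..3} \<Longrightarrow> \<eta> c p [u] = 0" "a \<in> {1..3}" "b \<in> {1..3}"
  shows "\<eta> a p [\<phi> b p u] = 0"
  unfolding eta_phi[OF assms(2,3)] using assms(1) by (intro sum.neutral) auto

text \<open>On horizontal vectors the structure tensors multiply like the quaternion units, so
  \<open>\<phi> a\<close> after \<open>\<phi> b\<close> stays in the span of \<open>w\<close> and
  its three images.\<close>

lemma quaternionic_perp_phi: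
  assumes w: "w \<in> quaternionic_perp p e" and b: "b \<in> {1..3}"
  shows "\<phi> b p w \<in> quaternionic_perp p e"
proof -
  have lin: "linear (g p e)" using metric_bilinear[OF atlas three_metric] by (auto simp: bilinear_def)
  show ?thesis
    using w b unfolding quaternionic_perp_def
    by (auto simp: eta_phi phi_phi linear_add[OF lin] linear_diff[OF lin] linear_sum[OF lin]
      linear_scale[OF lin] linear_0[OF lin])
qed

lemma quaternionic_perp_sym:
  assumes "w \<in> quaternionic_perp p e" "\<And>b. b \<in> {1..3} \<Longrightarrow> \<eta> b p [e] = 0"
  shows "e \<in> quaternionic_perp p w"
proof -
  have "g p w e = g p e w" by (rule metric_sym[OF atlas three_metric])
  moreover have "g p w (\<phi> a p e) = - g p e (\<phi> a p w)" if "a \<in> {1..3}" for a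
    by (rule Phi_skew_index[OF that])
  ultimately show ?thesis using assms by (simp add: quaternionic_perp_def)
qed

lemma exists_quaternionic_perp:
  assumes "m < n"
  obtains z where "z \<noteq> 0" "\<And>b. b \<in> {1..3} \<Longrightarrow> \<eta> b p [z] = 0" "\<And>i. i < m \<Longrightarrow> z \<in> quaternionic_perp p (e i)"
proof -
  \<comment> \<open>Index 0 stands for the identity among the quaternion units. With the Reeb
    vectors, \<open>W\<close> has at most 4m + 3 elements, fewer than the dimension 4n + 3.\<close>
  define f where "f = (\<lambda>(i, a). if a = 0 then e i else \<phi> a p (e i))"
  define W where "W = (\<lambda>b. \<xi> b p) ` {1..3} \<union> f ` ({..<m} \<times> {0..3})"
  have fin: "finite W" by (simp add: W_def)
  have "card W \<le> card ((\<lambda>b. \<xi> b p) ` {1..3}) + card (f ` ({..<m} \<times> {0..3}))"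
    unfolding W_def by (rule card_Un_le)
  also have "\<dots> \<le> 3 + m * 4"
    using card_image_le[of "{1..3}" "\<lambda>b. \<xi> b p"] card_image_le[of "{..<m} \<times> {0..3}" f]
    by (simp add: card_cartesian_product)
  finally have "dim W < DIM('e)" using dim_le_card[of W W] fin span_superset[of W] assms
    by (simp add: dim_model)
  then obtain x where x: "x \<noteq> 0" "\<And>y. y \<in> span W \<Longrightarrow> orthogonal x y"
    using orthogonal_to_subspace_exists by blast
  have "linear (\<lambda>w. x \<bullet> w)" by (simp add: bounded_linear.linear bounded_linear_inner_right)
  \<comment> \<open>\<open>x\<close> is orthogonal to \<open>W\<close> for the Euclidean inner
    product; its representative \<open>z\<close> is orthogonal to \<open>W\<close> for
    \<open>g p\<close>.\<close>
  then obtain z where z: "\<And>w. g p z w = x \<bullet> w" using metric_represents[OF atlas three_metric] by blast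
  have "g p z x \<noteq> 0" using z[of x] x(1) by simp
  then have "z \<noteq> 0" by (auto simp: g_linear)
  have zero: "g p z w = 0" if "w \<in> W" for w
    using x(2)[OF span_base[OF that]] z by (simp add: orthogonal_def)
  have eta: "\<eta> b p [z] = 0" if b: "b \<in> {1..3}" for b
  proof -
    have "g p z (\<xi> b p) = 0" by (rule zero) (use b in \<open>auto simp: W_def\<close>)
    then show ?thesis using metric_xi[OF b, of p z] metric_sym[OF atlas three_metric, of p z] by simp
  qed
  have "z \<in> quaternionic_perp p (e i)" if i: "i < m" for i
  proof -
    have "e i \<in> W" unfolding W_def using i by (auto simp: f_def intro!: image_eqI[of _ _ "(i, 0)"])
    then have "g p (e i) z = 0" using zero metric_sym[OF atlas three_metric, of p z] by metis
    moreover have "g p (e i) (\<phi> a p z) = 0" if a: "a \<in> {1..3}" for a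
    proof -
      have "\<phi> a p (e i) \<in> W" unfolding W_def using i a by (auto simp: f_def intro!: image_eqI[of _ _ "(i, a)"])
      then show ?thesis using zero Phi_skew_index[OF a, of p "e i" z] by simp
    qed
    ultimately show ?thesis using eta by (simp add: quaternionic_perp_def)
  qed
  then show ?thesis using that \<open>z \<noteq> 0\<close> eta by blast
qed

lemma quaternionic_frame_exists:
  assumes "m \<le> n"
  shows "\<exists>e. (\<forall>i<m. e i \<noteq> 0 \<and> (\<forall>b\<in>{1..3}. \<eta> b p [e i] = 0)) \<and>
     (\<forall>i<m. \<forall>j<m. i \<noteq> j \<longrightarrow> e j \<in> quaternionic_perp p (e i))"
  using assms
proof (induction m)
  case 0
  then show ?case by simp
next
  case (Suc m)
  then have "m \<le> n" by simp
  from Suc.IH[OF this] obtain e where e: "\<And>i. i < m \<Longrightarrow> e i \<noteq> 0" "\<And>i b. i < m \<Longrightarrow> b \<in> {1..3} \<Longrightarrow> \<eta> b p [e i] = 0"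
    "\<And>i j. i < m \<Longrightarrow> j < m \<Longrightarrow> i \<noteq> j \<Longrightarrow> e j \<in> quaternionic_perp p (e i)" by metis
  obtain z where z: "z \<noteq> 0" "\<And>b. b \<in> {1..3} \<Longrightarrow> \<eta> b p [z] = 0"
    "\<And>i. i < m \<Longrightarrow> z \<in> quaternionic_perp p (e i)"
    using exists_quaternionic_perp[of m p e] Suc.prems by auto
  have "e i \<in> quaternionic_perp p z" if "i < m" for i
    using quaternionic_perp_sym[OF z(3) e(2)] that by blast
  then show ?case using e z by (intro exI[of _ "e(m := z)"]) (auto simp: less_Suc_eq)
qed

text \<open>Inside each pair the image under \<phi> comes before the vector, which makes the values
  of the matching forms positive.\<close>

definition frame_list :: "'a \<Rightarrow> (nat \<Rightarrow> 'e) \<Rightarrow> nat \<Rightarrow> nat \<times> nat \<Rightarrow> 'e list" where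
  "frame_list p e k s =
     map (\<lambda>i. if even i then \<phi> (block_index s (i div 2)) p (e (i div 2)) else e (i div 2)) [0..<2 * k]"

lemma basic_betti_lower_bound:
  assumes "k \<le> n"
  shows "basic_betti A \<xi> \<eta> g (2 * k) \<ge> enat ((k + 2) choose 2)"
proof -
  \<comment> \<open>Any point serves: independence of the forms is already visible in one tangent
    space.\<close>
  fix p :: 'a
  let ?F = "horizontal_form \<phi> \<eta> g"
  obtain e where e: "\<And>i. i < k \<Longrightarrow> e i \<noteq> 0" "\<And>i b. i < k \<Longrightarrow> b \<in> {1..3} \<Longrightarrow> \<eta> b p [e i] = 0"
    and perp: "\<And>i j. i < k \<Longrightarrow> j < k \<Longrightarrow> i \<noteq> j \<Longrightarrow> e j \<in> quaternionic_perp p (e i)"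
    using quaternionic_frame_exists[OF assms, of p] by metis
  have len: "length (frame_list p e k t) = 2 * k" for t by (simp add: frame_list_def)
  have nth: "frame_list p e k t ! i = e (i div 2) \<or>
      (\<exists>b\<in>{1..3}. frame_list p e k t ! i = \<phi> b p (e (i div 2)))" if "i < 2 * k" for i t
    using that block_index_mem[of t "i div 2"] by (cases "even i") (auto simp: frame_list_def)
  have pair: "frame_list p e k t ! (2 * l) = \<phi> (block_index t l) p (e l)"
    "frame_list p e k t ! (2 * l + 1) = e l" if "l < k" for l t
    using that by (auto simp: frame_list_def)
  have diag: "?F a p (\<phi> b p (e l)) (e l) = (if a = b then g p (e l) (e l) else 0)"
    if a: "a \<in> {1..3}" and b: "b \<in> {1..3}" and l: "l < k" for a b l
  proof -
    have lin: "linear (g p (e l))" using metric_bilinear[OF atlas three_metric] by (auto simp: bilinear_def)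
    have z: "g p (e l) (\<phi> c p (e l)) = 0" if "c \<in> {1..3}" for c
      using Phi_skew_index[OF that, of p "e l" "e l"] by simp
    have "?F a p (\<phi> b p (e l)) (e l) = g p (\<phi> b p (e l)) (\<phi> a p (e l))"
      by (rule horizontal_form_horizontal[OF eta_phi_zero[OF e(2)[OF l] _ b]])
    \<comment> \<open>For equal indices the product of the two maps is minus the identity on
      \<open>e l\<close>; for distinct ones it is, up to sign, the third map, whose value is
      orthogonal to \<open>e l\<close>.\<close>
    also have "\<dots> = - g p (e l) (\<phi> b p (\<phi> a p (e l)))" by (rule phi_skew[OF b])
    also have "\<dots> = (if a = b then g p (e l) (e l) else 0)"
      by (simp add: phi_phi[OF b a] e(2)[OF l a] linear_diff[OF lin] linear_sum[OF lin]
          linear_scale[OF lin] linear_0[OF lin] linear_neg[OF lin] z)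
    finally show ?thesis .
  qed
  have cross: "?F a p (frame_list p e k t ! i) (frame_list p e k t ! j) = 0"
    if a: "a \<in> {1..3}" and ij: "i < 2 * k" "j < 2 * k" "i div 2 \<noteq> j div 2" for a i j t
  proof -
    let ?e = "e (i div 2)" and ?w = "\<phi> a p (frame_list p e k t ! j)"
    have less: "i div 2 < k" "j div 2 < k" using ij by auto
    have "e (j div 2) \<in> quaternionic_perp p ?e" using perp[OF less ij(3)] .
    then have "frame_list p e k t ! j \<in> quaternionic_perp p ?e"
      using nth[OF ij(2), of t] quaternionic_perp_phi by auto
    then have w: "?w \<in> quaternionic_perp p ?e" using quaternionic_perp_phi a by blast
    have "g p (frame_list p e k t ! i) ?w = 0"
      using nth[OF ij(1), of t]
    proof
      assume "\<exists>b\<in>{1..3}. frame_list p e k t ! i = \<phi> b p ?e"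
      then obtain b where b: "b \<in> {1..3}" "frame_list p e k t ! i = \<phi> b p ?e" by blast
      then show ?thesis using w phi_skew[OF b(1), of p ?e ?w] by (simp add: quaternionic_perp_def)
    qed (use w in \<open>simp add: quaternionic_perp_def\<close>)
    moreover have "\<eta> b p [frame_list p e k t ! i] = 0" if "b \<in> {1..3}" for b
      using nth[OF ij(1), of t] that e(2)[OF less(1)] eta_phi_zero[OF e(2)[OF less(1)] that] by metis
    ultimately show ?thesis by (subst horizontal_form_horizontal) auto
  qed
  let ?I = "{(i, j). i + j \<le> k}"
  have "enat (card ?I) \<le> form_dim (harmonic_forms_000 A \<xi> \<eta> g (2 * k))"
  proof (rule form_dim_lower_bound[where w = "parallel_power k" and p = p and v = "frame_list p e k"])
    show "finite ?I" by (rule finite_subset[of _ "{..k} \<times> {..k}"]) auto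
    show "parallel_power k s \<in> harmonic_forms_000 A \<xi> \<eta> g (2 * k)" for s
      by (rule parallel_power_harmonic_000)
    fix s
    let ?B = "\<lambda>m. ?F (block_index s m) p"
    have skew: "?B m u v = - ?B m v u" for m u v by (rule horizontal_form_skew[OF block_index_mem])
    have "pair_form k (\<lambda>m. ?F (block_index s m) p) (frame_list p e k s) > 0"
    proof (rule pair_form_pos[where B = ?B, OF len skew cross[OF block_index_mem]])
      show "?F (block_index s m) p (frame_list p e k s ! (2 * l)) (frame_list p e k s ! (2 * l + 1)) \<ge> 0"
        if "l < k" for m l
        unfolding pair[OF that] diag[OF block_index_mem block_index_mem that]
        using metric_pos[OF atlas three_metric e(1)[OF that], of p] by simp
      show "?F (block_index s m) p (frame_list p e k s ! (2 * m)) (frame_list p e k s ! (2 * m + 1)) > 0"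
        if "m < k" for m
        unfolding pair[OF that] diag[OF block_index_mem block_index_mem that]
        using metric_pos[OF atlas three_metric e(1)[OF that], of p] by simp
    qed
    then show "parallel_power k s p (frame_list p e k s) \<noteq> 0" by (simp add: parallel_power_def)
    fix t assume st: "s \<in> ?I" "t \<in> ?I" "s \<noteq> t"
    show "parallel_power k s p (frame_list p e k t) = 0"
    proof (rule ccontr)
      assume "parallel_power k s p (frame_list p e k t) \<noteq> 0"
      then have "pair_form k (\<lambda>m. ?F (block_index s m) p) (frame_list p e k t) \<noteq> 0"
        by (simp add: parallel_power_def)
      then obtain \<tau> where \<tau>: "\<tau> ` {..<k} \<subseteq> {..<k}" "inj_on \<tau> {..<k}"
        "\<And>m. m < k \<Longrightarrow> ?F (block_index s m) p (frame_list p e k t ! (2 * \<tau> m)) (frame_list p e k t ! (2 * \<tau> m + 1)) \<noteq> 0"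
        using pair_form_nonzero_matching[where B = ?B, OF len skew cross[OF block_index_mem]]
        by blast
      \<comment> \<open>By \<open>diag\<close>, a nonzero value on a pair forces the index of the
        factor to be the index used in that pair.\<close>
      have "block_index s m = block_index t (\<tau> m)" if "m < k" for m
      proof -
        have l: "\<tau> m < k" using \<tau>(1) that by auto
        show ?thesis using \<tau>(3)[OF that] unfolding pair[OF l] diag[OF block_index_mem block_index_mem l]
          by (auto split: if_splits)
      qed
      then show False using block_index_eqI[OF _ _ \<tau>(1,2), of s t] st by auto
    qed
  qed
  then show ?thesis by (simp add: basic_betti_def card_pairs_sum_le)
qed

end

theorem proposition6p1:
  fixes A :: "('a::{t2_space, second_countable_topology}, 'e::euclidean_space) chart set"
    and \<phi> :: "nat \<Rightarrow> ('a, 'e) endo"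
    and \<xi> :: "nat \<Rightarrow> ('a, 'e) vfield"
    and \<eta> :: "nat \<Rightarrow> ('a, 'e) form"
    and g :: "('a, 'e) bilin"
    and n k :: nat
  assumes "smooth_atlas A"
    and "compact (UNIV :: 'a set)"
    and "three_cosymplectic A n \<phi> \<xi> \<eta> g"
    and "k \<le> n"
  shows "basic_betti A \<xi> \<eta> g (2 * k) \<ge> enat ((k + 2) choose 2)"
  using basic_betti_lower_bound[OF assms(1,3,4)] .

end
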